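(* Let $K\le 2$. Then the homogeneous QCQP $$\max_{\mathbf{t}\in\mathbb{C}^{M}}\ \mathbf{t}^H\mathbf{A}\mathbf{t}\quad\text{s.t. } \mathbf{t}^H\mathbf{Q}_k\mathbf{t}\le1\ (k=1,\ldots,K),\quad \mathbf{t}^H\mathbf{t}\le P,$$ can be solved exactly in polynomial time. In particular, from an optimal solution $\mathbf{X}^*$ of its semidefinite relaxation $$\max_{\mathbf{X}\succeq\mathbf{0}}\ \mathrm{tr}(\mathbf{A}\mathbf{X})\quad\text{s.t. }\mathrm{tr}(\mathbf{Q}_k\mathbf{X})\le1\ (k=1,\ldots,K),\quad \mathrm{tr}(\mathbf{X})\le P,$$ one can construct in polynomial time an optimal solution $\hat{\mathbf{t}}$ of the QCQP.
   Context: $M\ge1$ and $K\geq 1$ are integers (number of secondary transmit antennae and of primary links), $\mathbf{A},\mathbf{Q}_1,\ldots,\mathbf{Q}_K\in\mathbb{C}^{M\times M}$ are Hermitian positive semidefinite matrices, $P>0$ is a real number, and $\mathbf{X}$ ranges over $M\times M$ Hermitian positive semidefinite matrices. $(\cdot)^H$ denotes conjugate transpose. Convention on complexity: an optimal solution of a semidefinite program is regarded as obtainable in polynomial time (by interior-point methods), and the construction of $\hat{\mathbf{t}}$ from $\mathbf{X}^*$ is to use a number of elementary operations on real/complex numbers (arithmetic, square roots, Cholesky factorizations, solving scalar quadratic equations, arguments of complex numbers) that is polynomial in $M$. *)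

theory Defs
  imports
    "HOL-Computational_Algebra.Polynomial"
    "Jordan_Normal_Form.Schur_Decomposition"
begin

section \<open>Hermitian and positive semidefinite matrices\<close>

definition hermitian_mat :: "nat \<Rightarrow> complex mat \<Rightarrow> bool" where
  "hermitian_mat n A \<longleftrightarrow> A \<in> carrier_mat n n \<and> mat_adjoint A = A"

text \<open>\<open>qform A t\<close> is \<open>t\<^sup>H A t\<close>: the product \<open>v \<bullet>c w\<close> conjugates its second argument. The
  quadratic form and the traces below are real for Hermitian arguments, so taking real parts
  loses nothing.\<close>

definition qform :: "complex mat \<Rightarrow> complex vec \<Rightarrow> real" where
  "qform A t = Re ((A *\<^sub>v t) \<bullet>c t)"

definition psd :: "nat \<Rightarrow> complex mat \<Rightarrow> bool" where
  "psd n A \<longleftrightarrow> hermitian_mat n A \<and> (\<forall>v \<in> carrier_vec n. 0 \<le> qform A v)"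

definition trace :: "complex mat \<Rightarrow> complex" where
  "trace A = (\<Sum>i<dim_row A. A $$ (i, i))"


section \<open>The quadratic program and its semidefinite relaxation\<close>

definition qcqp_data ::
    "nat \<Rightarrow> nat \<Rightarrow> complex mat \<Rightarrow> (nat \<Rightarrow> complex mat) \<Rightarrow> real \<Rightarrow> bool" where
  "qcqp_data M K A Q P \<longleftrightarrow>
     1 \<le> M \<and> 1 \<le> K \<and> psd M A \<and> (\<forall>k\<in>{1..K}. psd M (Q k)) \<and> 0 < P"

definition qcqp_feasible ::
    "nat \<Rightarrow> nat \<Rightarrow> (nat \<Rightarrow> complex mat) \<Rightarrow> real \<Rightarrow> complex vec \<Rightarrow> bool" where
  "qcqp_feasible M K Q P t \<longleftrightarrow>
     t \<in> carrier_vec M \<and> (\<forall>k\<in>{1..K}. qform (Q k) t \<le> 1) \<and> Re (t \<bullet>c t) \<le> P"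

definition qcqp_optimal ::
    "nat \<Rightarrow> nat \<Rightarrow> complex mat \<Rightarrow> (nat \<Rightarrow> complex mat) \<Rightarrow> real \<Rightarrow> complex vec \<Rightarrow> bool" where
  "qcqp_optimal M K A Q P t \<longleftrightarrow>
     qcqp_feasible M K Q P t \<and>
     (\<forall>u. qcqp_feasible M K Q P u \<longrightarrow> qform A u \<le> qform A t)"

text \<open>A semidefinite program is: maximise \<open>tr (C X)\<close> over the positive semidefinite \<open>X\<close> with
  \<open>tr (B X) \<le> b\<close> for every pair \<open>(B, b)\<close> in the list of constraints.\<close>

definition sdp_feasible ::
    "nat \<Rightarrow> (complex mat \<times> real) list \<Rightarrow> complex mat \<Rightarrow> bool" where
  "sdp_feasible n cs X \<longleftrightarrow> psd n X \<and> (\<forall>(B, b) \<in> set cs. Re (trace (B * X)) \<le> b)"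

definition sdp_optimal ::
    "nat \<Rightarrow> complex mat \<Rightarrow> (complex mat \<times> real) list \<Rightarrow> complex mat \<Rightarrow> bool" where
  "sdp_optimal n C cs X \<longleftrightarrow>
     sdp_feasible n cs X \<and>
     (\<forall>Y. sdp_feasible n cs Y \<longrightarrow> Re (trace (C * Y)) \<le> Re (trace (C * X)))"

definition relaxation ::
    "nat \<Rightarrow> nat \<Rightarrow> (nat \<Rightarrow> complex mat) \<Rightarrow> real \<Rightarrow> (complex mat \<times> real) list" where
  "relaxation M K Q P = map (\<lambda>k. (Q k, 1)) [1..<Suc K] @ [(1\<^sub>m M, P)]"


section \<open>The model of computation\<close>

text \<open>
  A random access machine over the complex numbers. A state consists of integer variables, used
  for indices and loop control, and of a store of two-dimensional complex arrays, the arrays being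
  numbered by naturals. Arithmetic on complex numbers is exact. Every operation has unit cost.
  A program is a fixed finite object, the same for all dimensions, and its constants are
  restricted to integers and the imaginary unit, so that it can carry no precomputed real data.

  Index arithmetic has only addition and truncated subtraction, so unit cost cannot be abused to
  build numbers with more than linearly many bits. Scalar quadratic equations and Cholesky
  factorizations are not primitive: they are programs over arithmetic and square roots, of
  constant and of cubic cost respectively.
\<close>

type_synonym vars = "nat \<Rightarrow> nat"
type_synonym store = "nat \<Rightarrow> nat \<Rightarrow> nat \<Rightarrow> complex"
type_synonym state = "vars \<times> store"

datatype iexp = INum nat | IVar nat | IAdd iexp iexp | ISub iexp iexp

datatype cexp =
    CNum int
  | CImag
  | CLoad iexp iexp iexp
  | CAdd cexp cexp
  | CSub cexp cexp
  | CMul cexp cexp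
  | CDiv cexp cexp
  | CCnj cexp
  | CSqrt cexp
  | CArg cexp

datatype bexp =
    BILess iexp iexp
  | BCEq cexp cexp
  | BCLe cexp cexp
  | BNot bexp
  | BAnd bexp bexp

datatype com =
    Skip
  | SetVar nat iexp
  | Store iexp iexp iexp cexp
  | Seq com com
  | Cond bexp com com
  | Loop bexp com
  | SolveSDP iexp iexp iexp iexp iexp iexp

fun ival :: "iexp \<Rightarrow> vars \<Rightarrow> nat" where
  "ival (INum n) \<sigma> = n"
| "ival (IVar x) \<sigma> = \<sigma> x"
| "ival (IAdd a b) \<sigma> = ival a \<sigma> + ival b \<sigma>"
| "ival (ISub a b) \<sigma> = ival a \<sigma> - ival b \<sigma>"

fun cval :: "cexp \<Rightarrow> state \<Rightarrow> complex" where
  "cval (CNum z) s = of_int z"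
| "cval CImag s = \<i>"
| "cval (CLoad a i j) s = snd s (ival a (fst s)) (ival i (fst s)) (ival j (fst s))"
| "cval (CAdd a b) s = cval a s + cval b s"
| "cval (CSub a b) s = cval a s - cval b s"
| "cval (CMul a b) s = cval a s * cval b s"
| "cval (CDiv a b) s = cval a s / cval b s"
| "cval (CCnj a) s = cnj (cval a s)"
| "cval (CSqrt a) s = csqrt (cval a s)"
| "cval (CArg a) s = complex_of_real (Arg (cval a s))"

text \<open>The order test \<open>BCLe\<close> compares real parts.\<close>

fun bval :: "bexp \<Rightarrow> state \<Rightarrow> bool" where
  "bval (BILess a b) s = (ival a (fst s) < ival b (fst s))"
| "bval (BCEq a b) s = (cval a s = cval b s)"
| "bval (BCLe a b) s = (Re (cval a s) \<le> Re (cval b s))"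
| "bval (BNot b) s = (\<not> bval b s)"
| "bval (BAnd b c) s = (bval b s \<and> bval c s)"

fun icost :: "iexp \<Rightarrow> nat" where
  "icost (INum n) = 1"
| "icost (IVar x) = 1"
| "icost (IAdd a b) = 1 + icost a + icost b"
| "icost (ISub a b) = 1 + icost a + icost b"

fun ccost :: "cexp \<Rightarrow> nat" where
  "ccost (CNum z) = 1"
| "ccost CImag = 1"
| "ccost (CLoad a i j) = 1 + icost a + icost i + icost j"
| "ccost (CAdd a b) = 1 + ccost a + ccost b"
| "ccost (CSub a b) = 1 + ccost a + ccost b"
| "ccost (CMul a b) = 1 + ccost a + ccost b"
| "ccost (CDiv a b) = 1 + ccost a + ccost b"
| "ccost (CCnj a) = 1 + ccost a"
| "ccost (CSqrt a) = 1 + ccost a"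
| "ccost (CArg a) = 1 + ccost a"

fun bcost :: "bexp \<Rightarrow> nat" where
  "bcost (BILess a b) = 1 + icost a + icost b"
| "bcost (BCEq a b) = 1 + ccost a + ccost b"
| "bcost (BCLe a b) = 1 + ccost a + ccost b"
| "bcost (BNot b) = 1 + bcost b"
| "bcost (BAnd b c) = 1 + bcost b + bcost c"

definition mat_of_array :: "nat \<Rightarrow> (nat \<Rightarrow> nat \<Rightarrow> complex) \<Rightarrow> complex mat" where
  "mat_of_array n f = mat n n (\<lambda>(i, j). f i j)"

definition array_of_mat :: "complex mat \<Rightarrow> nat \<Rightarrow> nat \<Rightarrow> complex" where
  "array_of_mat A i j = (if i < dim_row A \<and> j < dim_col A then A $$ (i, j) else 0)"

text \<open>An external solver maps a size, an objective and a list of constraints to an answer together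
  with the time spent on it, or to \<open>None\<close> if it has no answer.\<close>

type_synonym sdp_solver =
  "nat \<Rightarrow> complex mat \<Rightarrow> (complex mat \<times> real) list \<Rightarrow> (complex mat \<times> nat) option"

text \<open>\<open>exec orc c s t s'\<close>: started in \<open>s\<close>, the program \<open>c\<close> terminates in \<open>s'\<close> after time \<open>t\<close>, with
  \<open>orc\<close> answering the calls of \<open>SolveSDP\<close>. The arguments of \<open>SolveSDP n m a q r x\<close> are the size, the
  number of constraints, the array of the objective, the first of \<open>m\<close> consecutive constraint
  arrays, the array whose first column holds the right-hand sides, and the array receiving the
  answer. A call that the solver does not answer is stuck.\<close>

inductive exec :: "sdp_solver \<Rightarrow> com \<Rightarrow> state \<Rightarrow> nat \<Rightarrow> state \<Rightarrow> bool" for orc where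
  Skip: "exec orc Skip s 1 s"
| SetVar: "exec orc (SetVar x e) (\<sigma>, \<mu>) (1 + icost e) (\<sigma>(x := ival e \<sigma>), \<mu>)"
| Store: "exec orc (Store a i j e) (\<sigma>, \<mu>) (1 + icost a + icost i + icost j + ccost e)
    (\<sigma>, \<mu>(ival a \<sigma> := (\<mu> (ival a \<sigma>))
       (ival i \<sigma> := (\<mu> (ival a \<sigma>) (ival i \<sigma>)) (ival j \<sigma> := cval e (\<sigma>, \<mu>)))))"
| Seq: "exec orc c s t s' \<Longrightarrow> exec orc d s' u s'' \<Longrightarrow> exec orc (Seq c d) s (t + u) s''"
| CondTrue: "bval b s \<Longrightarrow> exec orc c s t s' \<Longrightarrow> exec orc (Cond b c d) s (1 + bcost b + t) s'"
| CondFalse: "\<not> bval b s \<Longrightarrow> exec orc d s t s' \<Longrightarrow> exec orc (Cond b c d) s (1 + bcost b + t) s'"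
| LoopFalse: "\<not> bval b s \<Longrightarrow> exec orc (Loop b c) s (1 + bcost b) s"
| LoopTrue: "bval b s \<Longrightarrow> exec orc c s t s' \<Longrightarrow> exec orc (Loop b c) s' u s'' \<Longrightarrow>
    exec orc (Loop b c) s (1 + bcost b + t + u) s''"
| SolveSDP:
    "orc (ival n \<sigma>) (mat_of_array (ival n \<sigma>) (\<mu> (ival a \<sigma>)))
       (map (\<lambda>k. (mat_of_array (ival n \<sigma>) (\<mu> (ival q \<sigma> + k)), Re (\<mu> (ival r \<sigma>) k 0)))
          [0..<ival m \<sigma>]) = Some (X, t) \<Longrightarrow>
     exec orc (SolveSDP n m a q r x) (\<sigma>, \<mu>)
       (1 + icost n + icost m + icost a + icost q + icost r + icost x + t)
       (\<sigma>, \<mu>(ival x \<sigma> := array_of_mat X))"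

text \<open>The convention that an optimal solution of a semidefinite program is obtainable in polynomial
  time: whenever an optimum is attained, the solver returns an optimal solution, within a time
  that is polynomial in the size of the matrices and the number of constraints.\<close>

definition poly_time_sdp_solver :: "sdp_solver \<Rightarrow> bool" where
  "poly_time_sdp_solver orc \<longleftrightarrow>
     (\<exists>p :: nat poly. \<forall>n C cs.
        hermitian_mat n C \<and> (\<forall>(B, b) \<in> set cs. hermitian_mat n B) \<and>
        (\<exists>X. sdp_optimal n C cs X) \<longrightarrow>
        (\<exists>X t. orc n C cs = Some (X, t) \<and> sdp_optimal n C cs X \<and> t \<le> poly p (n + length cs)))"

text \<open>Executions with \<open>no_solver\<close> are those that use elementary operations only.\<close>

definition no_solver :: sdp_solver where
  "no_solver n C cs = None"

text \<open>Layout of the data: variables 0 and 1 hold \<open>M\<close> and \<open>K\<close>; array 0 holds \<open>A\<close>, array 1 holds \<open>P\<close>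
  at position (0, 0), array \<open>3 + k\<close> holds \<open>Q k\<close> for \<open>1 \<le> k \<le> K\<close>. If a solution of the relaxation is
  part of the input, it is in array 2. The result is read off the first column of array 3.
  Everything else is initially 0.\<close>

definition input_vars :: "nat \<Rightarrow> nat \<Rightarrow> vars" where
  "input_vars M K = (\<lambda>_. 0)(0 := M, 1 := K)"

definition input_store ::
    "nat \<Rightarrow> complex mat \<Rightarrow> (nat \<Rightarrow> complex mat) \<Rightarrow> real \<Rightarrow> store" where
  "input_store K A Q P a i j =
     (if a = 0 then array_of_mat A i j
      else if a = 1 \<and> i = 0 \<and> j = 0 then complex_of_real P
      else if a \<in> {4..3 + K} then array_of_mat (Q (a - 3)) i j
      else 0)"

definition input_qcqp ::
    "nat \<Rightarrow> nat \<Rightarrow> complex mat \<Rightarrow> (nat \<Rightarrow> complex mat) \<Rightarrow> real \<Rightarrow> state" where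
  "input_qcqp M K A Q P = (input_vars M K, input_store K A Q P)"

definition input_qcqp_with ::
    "nat \<Rightarrow> nat \<Rightarrow> complex mat \<Rightarrow> (nat \<Rightarrow> complex mat) \<Rightarrow> real \<Rightarrow> complex mat \<Rightarrow> state" where
  "input_qcqp_with M K A Q P X = (input_vars M K, (input_store K A Q P)(2 := array_of_mat X))"

definition output_vec :: "nat \<Rightarrow> state \<Rightarrow> complex vec" where
  "output_vec M s = vec M (\<lambda>i. snd s 3 i 0)"

end

(*
A feasible X = sum_j v_j v_j^H of the relaxation is turned into one vector by merging v_1, v_2, ...
one at a time into w. Merging w and v means finding a Hermitian 2 x 2 matrix D, nonzero, on which the
compressions to span(w, v) of the (at most three) constraint matrices vanish: three real equations
in four unknowns. If l is the largest eigenvalue of D, then I - D/l is positive semidefinite of rank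
at most one, say z z^H, and z_1 w + z_2 v has the same constraint values as w and v together. The
sign of D is chosen such that the objective does not decrease and l > 0; both can be had because
the identity is among the constraint matrices. The decomposition of X is an outer-product Cholesky
factorization, which survives zero pivots because x / 0 = 0, and the same convention lets
Gram-Schmidt produce D without case distinctions. Attainment in the relaxation then follows from
compactness of the feasible set of the vector problem, since rounding never loses value.
*)

theory Submission
  imports
    "HOL-Analysis.Function_Topology"
    "HOL-Analysis.Topology_Euclidean_Space"
    Defs
begin

section \<open>Reasoning about programs\<close>

text \<open>The objective is not made a fourth equation: four equations in the four real unknowns of
  a Hermitian 2 x 2 matrix may have only the zero solution. This is also where K <= 2 enters, the
  power constraint being the third equation. For the objective an inequality suffices, and the sign
  of D supplies it. The danger is that the good sign is one without a positive l, that is, D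
  negative semidefinite. But D pairs to zero with the Gram matrix of (w, v), and definiteness then
  forces the combinations of w and v that D sees to vanish. So D pairs to zero with every form, the
  objective included, and the other sign can be taken. That l is an eigenvalue makes I - D/l
  singular, hence of rank at most one in dimension two; that it is the largest makes I - D/l
  positive semidefinite. Merging one vector at a time keeps the spectral part of the argument in
  dimension two, where it has closed formulas; all work that depends on M consists of loops with
  exactly M rounds.\<close>

fun time_bound :: "nat \<Rightarrow> nat \<Rightarrow> com \<Rightarrow> nat" where
  "time_bound n S Skip = 1"
| "time_bound n S (SetVar x e) = 1 + icost e"
| "time_bound n S (Store a i j e) = 1 + icost a + icost i + icost j + ccost e"
| "time_bound n S (Seq c d) = time_bound n S c + time_bound n S d"
| "time_bound n S (Cond b c d) = 1 + bcost b + time_bound n S c + time_bound n S d"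
| "time_bound n S (Loop b c) = Suc n * (1 + bcost b + time_bound n S c)"
| "time_bound n S (SolveSDP m k a q r x) =
    1 + icost m + icost k + icost a + icost q + icost r + icost x + S"

definition poly_bounded :: "(nat \<Rightarrow> nat) \<Rightarrow> bool" where
  "poly_bounded f \<longleftrightarrow> (\<exists>p :: nat poly. \<forall>n. f n \<le> poly p n)"

section \<open>Polynomial bounds are closed under sums and products\<close>

lemma poly_bounded_const: "poly_bounded (\<lambda>n. c)"
  unfolding poly_bounded_def by (rule exI[of _ "[:c:]"]) simp

lemma poly_bounded_Suc: "poly_bounded Suc"
  unfolding poly_bounded_def by (rule exI[of _ "[:1, 1:]"]) simp

lemma poly_bounded_add:
  assumes "poly_bounded f" "poly_bounded g"
  shows "poly_bounded (\<lambda>n. f n + g n)"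
proof -
  obtain p q :: "nat poly" where "\<And>n. f n \<le> poly p n" "\<And>n. g n \<le> poly q n"
    using assms unfolding poly_bounded_def by blast
  then show ?thesis
    unfolding poly_bounded_def by (intro exI[of _ "p + q"]) (simp add: add_mono)
qed

lemma poly_bounded_mult:
  assumes "poly_bounded f" "poly_bounded g"
  shows "poly_bounded (\<lambda>n. f n * g n)"
proof -
  obtain p q :: "nat poly" where "\<And>n. f n \<le> poly p n" "\<And>n. g n \<le> poly q n"
    using assms unfolding poly_bounded_def by blast
  then show ?thesis
    unfolding poly_bounded_def by (intro exI[of _ "p * q"]) (simp add: mult_mono)
qed

text \<open>For a fixed program the bound arises from constants, \<open>Suc n\<close> and
  \<open>S n\<close> by sums and products, so the polynomial can be read off the syntax without
  looking at executions.\<close>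

lemma poly_bounded_time_bound:
  assumes "poly_bounded S"
  shows "poly_bounded (\<lambda>n. time_bound n (S n) c)"
  by (induction c) (unfold time_bound.simps, (intro poly_bounded_add poly_bounded_mult
      poly_bounded_const poly_bounded_Suc assms | assumption)+)

text \<open>A program run at level \<open>x\<close> leaves the variables below \<open>x\<close> alone, so that nested loops can
  use increasing counters without interfering.\<close>

definition runs :: "sdp_solver \<Rightarrow> nat \<Rightarrow> nat \<Rightarrow> nat \<Rightarrow> com \<Rightarrow> vars \<Rightarrow> store \<Rightarrow> (store \<Rightarrow> bool) \<Rightarrow> bool"
  where "runs orc n S x c \<sigma> \<mu> R \<longleftrightarrow>
    (\<exists>t \<sigma>' \<mu>'. exec orc c (\<sigma>, \<mu>) t (\<sigma>', \<mu>') \<and> t \<le> time_bound n S c \<and>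
       (\<forall>y<x. \<sigma>' y = \<sigma> y) \<and> R \<mu>')"

lemma runs_Store:
  assumes "R (\<mu>(ival a \<sigma> := (\<mu> (ival a \<sigma>))
       (ival i \<sigma> := (\<mu> (ival a \<sigma>) (ival i \<sigma>)) (ival j \<sigma> := cval e (\<sigma>, \<mu>)))))"
  shows "runs orc n S x (Store a i j e) \<sigma> \<mu> R"
  unfolding runs_def
  by (intro exI conjI, rule exec.Store) (use assms in auto)

lemma runs_Seq:
  assumes "runs orc n S x c \<sigma> \<mu> R'"
    and "\<And>\<sigma>' \<mu>'. \<forall>y<x. \<sigma>' y = \<sigma> y \<Longrightarrow> R' \<mu>' \<Longrightarrow> runs orc n S x d \<sigma>' \<mu>' R"
  shows "runs orc n S x (Seq c d) \<sigma> \<mu> R"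
proof -
  obtain t \<sigma>' \<mu>' where 1: "exec orc c (\<sigma>, \<mu>) t (\<sigma>', \<mu>')" "t \<le> time_bound n S c"
      "\<forall>y<x. \<sigma>' y = \<sigma> y" "R' \<mu>'"
    using assms(1) unfolding runs_def by blast
  obtain u \<sigma>'' \<mu>'' where 2: "exec orc d (\<sigma>', \<mu>') u (\<sigma>'', \<mu>'')" "u \<le> time_bound n S d"
      "\<forall>y<x. \<sigma>'' y = \<sigma>' y" "R \<mu>''"
    using assms(2)[OF 1(3,4)] unfolding runs_def by blast
  show ?thesis
    unfolding runs_def using 1 2
    by (intro exI[of _ "t + u"] exI[of _ \<sigma>''] exI[of _ \<mu>''] conjI exec.Seq[OF 1(1) 2(1)]) auto
qed

lemma runs_weaken:
  assumes "runs orc n S x c \<sigma> \<mu> R" "\<And>\<mu>'. R \<mu>' \<Longrightarrow> R' \<mu>'"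
  shows "runs orc n S x c \<sigma> \<mu> R'"
  using assms unfolding runs_def by blast

text \<open>The limit is always variable 0, where the input keeps \<open>M\<close>. The factor
  \<open>Suc n\<close> in \<open>time_bound\<close> pays for the \<open>M\<close> rounds and the
  last, failing test.\<close>

definition For :: "nat \<Rightarrow> com \<Rightarrow> com" where
  "For x c = Seq (SetVar x (INum 0))
     (Loop (BILess (IVar x) (IVar 0)) (Seq c (SetVar x (IAdd (IVar x) (INum 1)))))"

text \<open>The body runs at level \<open>Suc x\<close>, so it cannot move the counter, and
  \<open>0 < x\<close> shields the limit in variable 0. Hence an invariant indexed by the counter is
  enough.\<close>

lemma runs_For:
  assumes x: "0 < x" and \<sigma>: "\<sigma> 0 = n" and init: "I 0 \<mu>"
    and step: "\<And>k \<sigma>' \<mu>'. k < n \<Longrightarrow> \<forall>y<x. \<sigma>' y = \<sigma> y \<Longrightarrow> \<sigma>' x = k \<Longrightarrow> I k \<mu>' \<Longrightarrow>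
      runs orc n S (Suc x) c \<sigma>' \<mu>' (I (Suc k))"
  shows "runs orc n S x (For x c) \<sigma> \<mu> (I n)"
proof -
  define b where "b = BILess (IVar x) (IVar 0)"
  define d where "d = Seq c (SetVar x (IAdd (IVar x) (INum 1)))"
  \<comment> \<open>Induction on the number of rounds still to come, which are granted the share
    \<open>Suc (n - k)\<close> of the time bound.\<close>
  have loop: "\<exists>t \<sigma>'' \<mu>''. exec orc (Loop b d) (\<sigma>', \<mu>') t (\<sigma>'', \<mu>'') \<and>
      t \<le> Suc (n - k) * (1 + bcost b + time_bound n S d) \<and> (\<forall>y<x. \<sigma>'' y = \<sigma> y) \<and> I n \<mu>''"
    if "k \<le> n" "\<forall>y<x. \<sigma>' y = \<sigma> y" "\<sigma>' x = k" "I k \<mu>'" for k \<sigma>' \<mu>'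
    using that
  proof (induction "n - k" arbitrary: k \<sigma>' \<mu>')
    case 0
    then have "k = n" by simp
    then have "exec orc (Loop b d) (\<sigma>', \<mu>') (1 + bcost b) (\<sigma>', \<mu>')"
      using 0 x \<sigma> by (intro exec.LoopFalse) (simp add: b_def)
    then show ?case using 0 \<open>k = n\<close>
      by (intro exI[of _ "1 + bcost b"] exI[of _ \<sigma>'] exI[of _ \<mu>'] conjI) auto
  next
    case (Suc m)
    then have k: "k < n" by simp
    obtain t \<tau> \<nu> where 1: "exec orc c (\<sigma>', \<mu>') t (\<tau>, \<nu>)" "t \<le> time_bound n S c"
        "\<forall>y<Suc x. \<tau> y = \<sigma>' y" "I (Suc k) \<nu>"
      using step[OF k Suc.prems(2-4)] unfolding runs_def by blast
    define u where "u = time_bound n S (SetVar x (IAdd (IVar x) (INum 1)))"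
    have 2: "exec orc d (\<sigma>', \<mu>') (t + u) (\<tau>(x := Suc k), \<nu>)"
      using exec.Seq[OF 1(1) exec.SetVar[of orc x "IAdd (IVar x) (INum 1)" \<tau> \<nu>]] 1(3) Suc.prems(3)
      unfolding d_def u_def by simp
    have "\<exists>t \<sigma>'' \<mu>''. exec orc (Loop b d) (\<tau>(x := Suc k), \<nu>) t (\<sigma>'', \<mu>'') \<and>
        t \<le> Suc (n - Suc k) * (1 + bcost b + time_bound n S d) \<and> (\<forall>y<x. \<sigma>'' y = \<sigma> y) \<and> I n \<mu>''"
      by (rule Suc.hyps(1)) (use Suc.hyps(2) Suc.prems 1 k in auto)
    then obtain v \<sigma>'' \<mu>'' where 3: "exec orc (Loop b d) (\<tau>(x := Suc k), \<nu>) v (\<sigma>'', \<mu>'')"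
        "v \<le> Suc (n - Suc k) * (1 + bcost b + time_bound n S d)" "\<forall>y<x. \<sigma>'' y = \<sigma> y" "I n \<mu>''"
      by blast
    have "bval b (\<sigma>', \<mu>')"
      using k Suc.prems x \<sigma> by (simp add: b_def)
    from exec.LoopTrue[OF this 2 3(1)]
    have "exec orc (Loop b d) (\<sigma>', \<mu>') (1 + bcost b + (t + u) + v) (\<sigma>'', \<mu>'')" .
    moreover have "1 + bcost b + (t + u) + v \<le> Suc (n - k) * (1 + bcost b + time_bound n S d)"
    proof -
      have "t + u \<le> time_bound n S d"
        using 1(2) by (simp add: d_def u_def)
      moreover have "Suc (n - k) = Suc (Suc (n - Suc k))"
        using k by simp
      ultimately show ?thesis
        using 3(2) by simp
    qed
    ultimately show ?case using 3(3,4) by blast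
  qed
  have "\<exists>t \<sigma>'' \<mu>''. exec orc (Loop b d) (\<sigma>(x := 0), \<mu>) t (\<sigma>'', \<mu>'') \<and>
      t \<le> Suc (n - 0) * (1 + bcost b + time_bound n S d) \<and> (\<forall>y<x. \<sigma>'' y = \<sigma> y) \<and> I n \<mu>''"
    by (rule loop) (use init in auto)
  then obtain t \<sigma>'' \<mu>'' where 1: "exec orc (Loop b d) (\<sigma>(x := 0), \<mu>) t (\<sigma>'', \<mu>'')"
      "t \<le> Suc n * (1 + bcost b + time_bound n S d)" "\<forall>y<x. \<sigma>'' y = \<sigma> y" "I n \<mu>''"
    by auto
  have "exec orc (SetVar x (INum 0)) (\<sigma>, \<mu>) (1 + icost (INum 0)) (\<sigma>(x := 0), \<mu>)"
    using exec.SetVar[of orc x "INum 0" \<sigma> \<mu>] by simp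
  from exec.Seq[OF this 1(1)] show ?thesis
    unfolding runs_def For_def b_def[symmetric] d_def[symmetric] using 1(2-4)
    by (intro exI[of _ "1 + icost (INum 0) + t"] exI[of _ \<sigma>''] exI[of _ \<mu>''] conjI) auto
qed

section \<open>Derived expressions\<close>

definition cneg :: "cexp \<Rightarrow> cexp" where "cneg e = CSub (CNum 0) e"

lemma cval_cneg [simp]: "cval (cneg e) s = - cval e s"
  by (simp add: cneg_def)

definition cre :: "cexp \<Rightarrow> cexp" where "cre e = CDiv (CAdd e (CCnj e)) (CNum 2)"

lemma cval_cre [simp]: "cval (cre e) s = complex_of_real (Re (cval e s))"
  by (simp add: cre_def complex_add_cnj)

definition cim :: "cexp \<Rightarrow> cexp" where "cim e = cre (cneg (CMul CImag e))"

lemma cval_cim [simp]: "cval (cim e) s = complex_of_real (Im (cval e s))"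
  by (simp add: cim_def)

text \<open>Since \<open>x / x\<close> is 1 for nonzero \<open>x\<close> and 0 for \<open>x = 0\<close>, case distinctions are expressions.\<close>

definition cite :: "cexp \<Rightarrow> cexp \<Rightarrow> cexp \<Rightarrow> cexp" where
  "cite x a b = CAdd (CMul (CDiv x x) a) (CMul (CSub (CNum 1) (CDiv x x)) b)"

lemma cval_cite [simp]: "cval (cite x a b) s = (if cval x s \<noteq> 0 then cval a s else cval b s)"
  by (simp add: cite_def)

text \<open>For a real value \<open>t\<close>, the expression \<open>t + \<bar>t\<bar>\<close> is nonzero exactly if \<open>t > 0\<close>.\<close>

definition cpos :: "cexp \<Rightarrow> cexp" where "cpos e = CAdd e (CSqrt (CMul e e))"

lemma csqrt_of_real: "0 \<le> r \<Longrightarrow> csqrt (complex_of_real r) = complex_of_real (sqrt r)"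
  by (rule of_real_sqrt[symmetric])

lemma cval_cpos [simp]:
  "cval e s = complex_of_real r \<Longrightarrow> cval (cpos e) s \<noteq> 0 \<longleftrightarrow> 0 < r"
proof -
  assume e: "cval e s = complex_of_real r"
  have "cval (cpos e) s = complex_of_real (r + \<bar>r\<bar>)"
    using csqrt_of_real[of "r * r"] by (simp add: cpos_def e)
  then show ?thesis
    by (cases "0 < r") (simp, simp add: abs_if not_less)
qed

section \<open>A kernel vector of three linear forms on a four-dimensional space\<close>

definition dot4 :: "(nat \<Rightarrow> real) \<Rightarrow> (nat \<Rightarrow> real) \<Rightarrow> real" where
  "dot4 x y = x 0 * y 0 + x 1 * y 1 + x 2 * y 2 + x 3 * y 3"

text \<open>The component of \<open>x\<close> orthogonal to \<open>q\<close>; by division by zero it is \<open>x\<close> itself if \<open>q = 0\<close>.\<close>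

definition rej :: "(nat \<Rightarrow> real) \<Rightarrow> (nat \<Rightarrow> real) \<Rightarrow> nat \<Rightarrow> real" where
  "rej q x k = x k - dot4 x q / dot4 q q * q k"

definition unit4 :: "nat \<Rightarrow> nat \<Rightarrow> real" where
  "unit4 j k = (if k = j then 1 else 0)"

text \<open>Gram-Schmidt on \<open>a\<close>, \<open>b\<close>, \<open>c\<close> unfolded into a
  single term: the \<open>j\<close>-th unit vector projected to the orthogonal complement of their
  span. A dependent vector turns into zero, and rejecting by zero changes nothing.\<close>

definition proj4 :: "(nat \<Rightarrow> real) \<Rightarrow> (nat \<Rightarrow> real) \<Rightarrow> (nat \<Rightarrow> real) \<Rightarrow> nat \<Rightarrow> nat \<Rightarrow> real" where
  "proj4 a b c j = rej (rej (rej a b) (rej a c)) (rej (rej a b) (rej a (unit4 j)))"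

definition sel4 :: "(nat \<Rightarrow> real) \<Rightarrow> (nat \<Rightarrow> real) \<Rightarrow> nat \<Rightarrow> real" where
  "sel4 x y k = (if dot4 x x \<noteq> 0 then x k else y k)"

text \<open>The complement of three vectors in dimension four contains the nonzero projection of
  some unit vector; the first such projection is taken.\<close>

definition kernel4 :: "(nat \<Rightarrow> real) \<Rightarrow> (nat \<Rightarrow> real) \<Rightarrow> (nat \<Rightarrow> real) \<Rightarrow> nat \<Rightarrow> real" where
  "kernel4 a b c = sel4 (proj4 a b c 0) (sel4 (proj4 a b c 1) (sel4 (proj4 a b c 2) (proj4 a b c 3)))"

lemma dot4_commute: "dot4 x y = dot4 y x"
  by (simp add: dot4_def mult.commute)

lemma dot4_self_eq_0: "dot4 x x = 0 \<longleftrightarrow> x 0 = 0 \<and> x 1 = 0 \<and> x 2 = 0 \<and> x 3 = 0"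
proof -
  have "dot4 x x = (x 0)\<^sup>2 + (x 1)\<^sup>2 + ((x 2)\<^sup>2 + (x 3)\<^sup>2)"
    by (simp add: dot4_def power2_eq_square)
  then show ?thesis
    by (simp only: add_nonneg_eq_0_iff add_nonneg_nonneg zero_le_power2) auto
qed

lemma dot4_self_0_left: "dot4 q q = 0 \<Longrightarrow> dot4 q y = 0"
  unfolding dot4_self_eq_0 by (simp add: dot4_def)

lemma dot4_rej: "dot4 (rej q x) y = dot4 x y - dot4 x q / dot4 q q * dot4 q y"
proof -
  have "dot4 (\<lambda>k. x k - t * q k) y = dot4 x y - t * dot4 q y" for t
    by (simp add: dot4_def algebra_simps)
  from this[of "dot4 x q / dot4 q q"] show ?thesis by (simp only: rej_def[abs_def])
qed

text \<open>This covers \<open>q = 0\<close> as well: then \<open>rej q x\<close> is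
  \<open>x\<close>, which is orthogonal to zero.\<close>

lemma dot4_rej_self: "dot4 (rej q x) q = 0"
  using dot4_self_0_left[of q x] by (auto simp: dot4_rej dot4_commute[of x q])

lemma dot4_rej_orth: "dot4 x y = 0 \<Longrightarrow> dot4 q y = 0 \<Longrightarrow> dot4 (rej q x) y = 0"
  by (simp add: dot4_rej)

text \<open>Carries orthogonality from the Gram-Schmidt vectors back to the vectors they were made
  from.\<close>

lemma dot4_rej_rej: "dot4 q y = 0 \<Longrightarrow> dot4 y (rej q x) = dot4 y x"
  using dot4_rej[of q x y] by (simp add: dot4_commute[of y x] dot4_commute[of y "rej q x"])

lemma dot4_rej_norm: "dot4 (rej q x) (rej q x) = dot4 x x - (dot4 x q)\<^sup>2 / dot4 q q"
proof -
  have "dot4 (rej q x) (rej q x) = dot4 (rej q x) x"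
    by (rule dot4_rej_rej) (metis dot4_commute dot4_rej_self)
  then show ?thesis
    by (simp add: dot4_rej power2_eq_square dot4_commute[of q x])
qed

context
  fixes a b c q2 q3 :: "nat \<Rightarrow> real"
  defines "q2 \<equiv> rej a b" and "q3 \<equiv> rej q2 (rej a c)"
begin

lemma gram_schmidt_orth: "dot4 q2 a = 0" "dot4 q3 a = 0" "dot4 q3 q2 = 0"
  unfolding q3_def by (simp_all add: q2_def dot4_rej_self dot4_rej_orth)

lemma proj4_eq: "proj4 a b c j = rej q3 (rej q2 (rej a (unit4 j)))"
  by (simp add: proj4_def q3_def q2_def)

lemma proj4_orth: "dot4 (proj4 a b c j) a = 0" "dot4 (proj4 a b c j) b = 0" "dot4 (proj4 a b c j) c = 0"
proof -
  let ?x = "proj4 a b c j"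
  show a: "dot4 ?x a = 0"
    unfolding proj4_eq by (intro dot4_rej_orth dot4_rej_self gram_schmidt_orth)
  have q2: "dot4 ?x q2 = 0"
    unfolding proj4_eq by (intro dot4_rej_orth dot4_rej_self gram_schmidt_orth)
  have q3: "dot4 ?x q3 = 0"
    unfolding proj4_eq by (intro dot4_rej_orth dot4_rej_self gram_schmidt_orth)
  have a': "dot4 a ?x = 0" using a by (simp add: dot4_commute)
  have q2': "dot4 q2 ?x = 0" using q2 by (simp add: dot4_commute)
  show "dot4 ?x b = 0"
    using q2 dot4_rej_rej[OF a'] by (simp add: q2_def)
  show "dot4 ?x c = 0"
    using q3 dot4_rej_rej[OF q2'] dot4_rej_rej[OF a'] by (simp add: q3_def)
qed

text \<open>Pythagoras three times. Since \<open>a\<close>, \<open>q2\<close>, \<open>q3\<close> are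
  mutually orthogonal, each rejection removes the component that the unit vector itself has along
  the rejected vector, which is a single coordinate.\<close>

lemma proj4_norm:
  assumes "j < 4"
  shows "dot4 (proj4 a b c j) (proj4 a b c j) =
    1 - (a j)\<^sup>2 / dot4 a a - (q2 j)\<^sup>2 / dot4 q2 q2 - (q3 j)\<^sup>2 / dot4 q3 q3"
proof -
  have j: "j = 0 \<or> j = 1 \<or> j = 2 \<or> j = 3"
    using assms by auto
  have u: "dot4 (unit4 j) y = y j" for y
    using j by (auto simp: dot4_def unit4_def)
  have "dot4 (rej a (unit4 j)) q2 = q2 j"
    using gram_schmidt_orth by (simp add: dot4_rej u dot4_commute[of a q2])
  moreover have "dot4 (rej q2 (rej a (unit4 j))) q3 = q3 j"
    using gram_schmidt_orth by (simp add: dot4_rej u dot4_commute[of a q3] dot4_commute[of q2 q3])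
  moreover have "dot4 (unit4 j) (unit4 j) = 1"
    unfolding u by (simp add: unit4_def)
  ultimately show ?thesis
    unfolding proj4_eq by (simp add: dot4_rej_norm u)
qed

text \<open>The squared norms of the four projections sum to the dimension of the orthogonal complement.\<close>

lemma proj4_nonzero: "\<exists>j<4. dot4 (proj4 a b c j) (proj4 a b c j) \<noteq> 0"
proof (rule ccontr)
  assume "\<not> ?thesis"
  then have "\<And>j. j < 4 \<Longrightarrow> 1 = (a j)\<^sup>2 / dot4 a a + (q2 j)\<^sup>2 / dot4 q2 q2 + (q3 j)\<^sup>2 / dot4 q3 q3"
    using proj4_norm by (smt (verit))
  from this[of 0] this[of 1] this[of 2] this[of 3]
  have "4 = ((a 0)\<^sup>2 / dot4 a a + (a 1)\<^sup>2 / dot4 a a + (a 2)\<^sup>2 / dot4 a a + (a 3)\<^sup>2 / dot4 a a)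
      + ((q2 0)\<^sup>2 / dot4 q2 q2 + (q2 1)\<^sup>2 / dot4 q2 q2 + (q2 2)\<^sup>2 / dot4 q2 q2 + (q2 3)\<^sup>2 / dot4 q2 q2)
      + ((q3 0)\<^sup>2 / dot4 q3 q3 + (q3 1)\<^sup>2 / dot4 q3 q3 + (q3 2)\<^sup>2 / dot4 q3 q3 + (q3 3)\<^sup>2 / dot4 q3 q3)"
    by simp
  \<comment> \<open>Each of \<open>a\<close>, \<open>q2\<close>, \<open>q3\<close> contributes 1, or
    0 if it vanishes, so that four zero projections would give 4 <= 3.\<close>
  moreover have "(q 0)\<^sup>2 / dot4 q q + (q 1)\<^sup>2 / dot4 q q + (q 2)\<^sup>2 / dot4 q q + (q 3)\<^sup>2 / dot4 q q \<le> 1" for q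
  proof -
    have "(q 0)\<^sup>2 / dot4 q q + (q 1)\<^sup>2 / dot4 q q + (q 2)\<^sup>2 / dot4 q q + (q 3)\<^sup>2 / dot4 q q
        = dot4 q q / dot4 q q"
      by (simp add: add_divide_distrib[symmetric] dot4_def power2_eq_square)
    then show ?thesis by (metis divide_self_if order.refl zero_le_one)
  qed
  from this[of a] this[of q2] this[of q3] calculation show False by linarith
qed

end

lemma sel4_eq: "sel4 x y = (if dot4 x x \<noteq> 0 then x else y)"
  by (auto simp: sel4_def)

lemma kernel4_orth:
  "dot4 (kernel4 a b c) a = 0" "dot4 (kernel4 a b c) b = 0" "dot4 (kernel4 a b c) c = 0"
  unfolding kernel4_def sel4_eq using proj4_orth by auto

lemma kernel4_nonzero: "dot4 (kernel4 a b c) (kernel4 a b c) \<noteq> 0"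
proof -
  obtain j where "j < 4" "dot4 (proj4 a b c j) (proj4 a b c j) \<noteq> 0"
    using proj4_nonzero by blast
  moreover from this have "j = 0 \<or> j = 1 \<or> j = 2 \<or> j = 3" by auto
  ultimately show ?thesis
    unfolding kernel4_def sel4_eq by auto
qed

section \<open>Merging two vectors\<close>

text \<open>A vector \<open>\<delta>\<close> with four real entries stands for the Hermitian matrix with diagonal
  \<open>\<delta> 0\<close>, \<open>\<delta> 1\<close> and upper right entry \<open>(\<delta> 2 - \<i> * \<delta> 3) / 2\<close>; \<open>lam4 \<delta>\<close> is twice its largest eigenvalue.\<close>

definition lam4 :: "(nat \<Rightarrow> real) \<Rightarrow> real" where
  "lam4 d = d 0 + d 1 + sqrt ((d 0 - d 1) * (d 0 - d 1) + d 2 * d 2 + d 3 * d 3)"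

definition neg4 :: "(nat \<Rightarrow> real) \<Rightarrow> nat \<Rightarrow> real" where
  "neg4 d k = - d k"

definition orient4 :: "(nat \<Rightarrow> real) \<Rightarrow> (nat \<Rightarrow> real) \<Rightarrow> nat \<Rightarrow> real" where
  "orient4 r d k = (if dot4 r d > 0 then neg4 d k else if lam4 d > 0 then d k else neg4 d k)"

lemma dot4_neg4 [simp]: "dot4 r (neg4 d) = - dot4 r d"
  by (simp add: dot4_def neg4_def)

text \<open>Negation reverses the spectrum. If neither sign had a positive eigenvalue, all
  eigenvalues would be zero, and a Hermitian matrix with zero spectrum is zero.\<close>

lemma lam4_cases: "lam4 d > 0 \<or> lam4 (neg4 d) > 0" if "dot4 d d \<noteq> 0"
proof (rule ccontr)
  define D where "D = (d 0 - d 1) * (d 0 - d 1) + d 2 * d 2 + d 3 * d 3"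
  assume "\<not> ?thesis"
  moreover have "(neg4 d 0 - neg4 d 1) * (neg4 d 0 - neg4 d 1) + neg4 d 2 * neg4 d 2 + neg4 d 3 * neg4 d 3 = D"
    by (simp add: neg4_def D_def algebra_simps)
  ultimately have le: "d 0 + d 1 + sqrt D \<le> 0" "- d 0 - d 1 + sqrt D \<le> 0"
    unfolding lam4_def D_def[symmetric] by (simp_all add: neg4_def)
  have D0: "0 \<le> D" by (simp add: D_def)
  then have "0 \<le> sqrt D" by simp
  with le have "sqrt D = 0" "d 0 + d 1 = 0" by linarith+
  then have "(d 0 - d 1)\<^sup>2 + ((d 2)\<^sup>2 + (d 3)\<^sup>2) = 0"
    using D0 by (simp add: D_def power2_eq_square)
  then have "d 0 - d 1 = 0" "d 2 = 0" "d 3 = 0"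
    by (simp_all only: add_nonneg_eq_0_iff add_nonneg_nonneg zero_le_power2) auto
  with \<open>d 0 + d 1 = 0\<close> that show False
    by (simp add: dot4_def)
qed

text \<open>The second assumption keeps the two wishes from conflicting. If \<open>r\<close> pairs
  nontrivially with \<open>d\<close>, both signs have positive \<open>lam4\<close> and the sign may
  serve \<open>r\<close>; otherwise the sign is irrelevant for \<open>r\<close> and
  \<open>lam4_cases\<close> provides one.\<close>

lemma orient4:
  assumes "dot4 d d \<noteq> 0"
    and "\<And>e. e \<in> {d, neg4 d} \<Longrightarrow> lam4 e \<le> 0 \<Longrightarrow> dot4 r e = 0"
  shows "lam4 (orient4 r d) > 0" "dot4 r (orient4 r d) \<le> 0" "orient4 r d \<in> {d, neg4 d}"
proof -
  have eq: "orient4 r d = (if dot4 r d > 0 then neg4 d else if lam4 d > 0 then d else neg4 d)"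
    by (auto simp: orient4_def)
  have 1: "\<not> lam4 d > 0 \<Longrightarrow> dot4 r d = 0" "\<not> lam4 (neg4 d) > 0 \<Longrightarrow> dot4 r d = 0"
    using assms(2)[of d] assms(2)[of "neg4 d"] by auto
  show "lam4 (orient4 r d) > 0" "dot4 r (orient4 r d) \<le> 0" "orient4 r d \<in> {d, neg4 d}"
    using 1 lam4_cases[OF assms(1)] unfolding eq by (cases "lam4 (neg4 d) > 0"; auto)+
qed

text \<open>With \<open>coef2\<close> this is the factor \<open>z\<close> of the rank-one matrix I -
  2D/\<open>lam4 d\<close>, where \<open>D\<close> is the matrix encoded by \<open>d\<close>; the
  phase is fixed by making \<open>coef1\<close> a nonnegative real. If \<open>coef1\<close> is zero,
  so is the off-diagonal entry, and \<open>coef2\<close> is the root of the other diagonal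
  entry.\<close>

definition coef1 :: "(nat \<Rightarrow> real) \<Rightarrow> complex" where
  "coef1 d = csqrt (complex_of_real (1 - 2 * d 0 / lam4 d))"

definition coef2 :: "(nat \<Rightarrow> real) \<Rightarrow> complex" where
  "coef2 d = (if coef1 d \<noteq> 0 then (\<i> * complex_of_real (d 3 / lam4 d) - complex_of_real (d 2 / lam4 d)) / coef1 d
     else csqrt (complex_of_real (1 - 2 * d 1 / lam4 d)))"

text \<open>The right-hand sides are the entries of I - 2D/\<open>lam4 d\<close>, the entry at (i,
  k) being \<open>cnj z_i * z_k\<close>.\<close>

lemma coefs:
  assumes "lam4 d > 0"
  shows "(cmod (coef1 d))\<^sup>2 = 1 - 2 * d 0 / lam4 d"
    and "(cmod (coef2 d))\<^sup>2 = 1 - 2 * d 1 / lam4 d"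
    and "cnj (coef1 d) * coef2 d = Complex (- d 2 / lam4 d) (d 3 / lam4 d)"
proof -
  define l p r where "l = lam4 d" and "p = 1 - 2 * d 0 / l" and "r = 1 - 2 * d 1 / l"
  have l: "l > 0" using assms by (simp add: l_def)
  define D where "D = (d 0 - d 1) * (d 0 - d 1) + d 2 * d 2 + d 3 * d 3"
  have "0 \<le> D" by (simp add: D_def)
  have lD: "l = d 0 + d 1 + sqrt D" by (simp add: l_def lam4_def D_def)
  have "(d 0 - d 1)\<^sup>2 \<le> D" by (simp add: D_def power2_eq_square)
  then have "\<bar>d 0 - d 1\<bar> \<le> sqrt D" by (metis real_sqrt_abs real_sqrt_le_mono)
  \<comment> \<open>A diagonal entry of a Hermitian matrix is at most its largest eigenvalue, here
    \<open>l / 2\<close>.\<close>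
  then have "2 * d 0 \<le> l" "2 * d 1 \<le> l" using lD by linarith+
  then have p: "0 \<le> p" and r: "0 \<le> r" using l by (simp_all add: p_def r_def)
  have "(l - d 0 - d 1)\<^sup>2 = D" using lD \<open>0 \<le> D\<close> by simp
  \<comment> \<open>The characteristic equation of \<open>D\<close> at \<open>l / 2\<close>,
    multiplied by 4. It says that I - 2D/\<open>l\<close> has determinant zero.\<close>
  then have "(l - 2 * d 0) * (l - 2 * d 1) = (d 2)\<^sup>2 + (d 3)\<^sup>2"
    unfolding D_def by (simp add: power2_eq_square algebra_simps)
  moreover have "p * r = ((l - 2 * d 0) * (l - 2 * d 1)) / l\<^sup>2"
    using l by (simp add: p_def r_def field_simps power2_eq_square)
  ultimately have pr: "p * r = ((d 2)\<^sup>2 + (d 3)\<^sup>2) / l\<^sup>2" by simp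
  have c1: "coef1 d = complex_of_real (sqrt p)"
    using p csqrt_of_real[of p] by (simp add: coef1_def p_def l_def)
  show "(cmod (coef1 d))\<^sup>2 = 1 - 2 * d 0 / lam4 d"
    using p by (simp add: c1) (simp add: p_def l_def)
  define g where "g = Complex (- d 2 / l) (d 3 / l)"
  have g: "\<i> * complex_of_real (d 3 / l) - complex_of_real (d 2 / l) = g"
    by (simp add: g_def complex_eq_iff)
  have g2: "(cmod g)\<^sup>2 = p * r"
    unfolding pr by (simp add: g_def cmod_power2 power_divide add_divide_distrib)
  have c2: "coef2 d = (if p \<noteq> 0 then g / complex_of_real (sqrt p) else complex_of_real (sqrt r))"
    using r csqrt_of_real[of r] unfolding coef2_def c1 l_def[symmetric] r_def[symmetric] g by simp
  have "(cmod (coef2 d))\<^sup>2 = r"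
  proof (cases "p = 0")
    case False
    then have "(cmod (coef2 d))\<^sup>2 = (p * r) / p"
      using p by (simp add: c2 norm_divide power_divide g2)
    then show ?thesis using False by simp
  qed (use r in \<open>simp add: c2\<close>)
  then show "(cmod (coef2 d))\<^sup>2 = 1 - 2 * d 1 / lam4 d" by (simp add: r_def l_def)
  \<comment> \<open>For \<open>p = 0\<close> the product is 0, and \<open>g2\<close> forces
    \<open>g = 0\<close> too.\<close>
  have "cnj (coef1 d) * coef2 d = g"
    using g2 by (auto simp: c1 c2)
  then show "cnj (coef1 d) * coef2 d = Complex (- d 2 / lam4 d) (d 3 / lam4 d)"
    by (simp add: g_def l_def)
qed

section \<open>Sesquilinear forms of arrays\<close>

type_synonym arr = "nat \<Rightarrow> nat \<Rightarrow> complex"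

definition form :: "nat \<Rightarrow> arr \<Rightarrow> (nat \<Rightarrow> complex) \<Rightarrow> (nat \<Rightarrow> complex) \<Rightarrow> complex" where
  "form n B u v = (\<Sum>i<n. \<Sum>k<n. cnj (u i) * B i k * v k)"

definition tr_prod :: "nat \<Rightarrow> arr \<Rightarrow> arr \<Rightarrow> complex" where
  "tr_prod n B X = (\<Sum>i<n. \<Sum>k<n. B i k * X k i)"

definition herm :: "nat \<Rightarrow> arr \<Rightarrow> bool" where
  "herm n B \<longleftrightarrow> (\<forall>i<n. \<forall>k<n. B k i = cnj (B i k))"

definition psd_arr :: "nat \<Rightarrow> arr \<Rightarrow> bool" where
  "psd_arr n X \<longleftrightarrow> herm n X \<and> (\<forall>u. 0 \<le> Re (form n X u u))"

lemma herm_cnj: "herm n B \<Longrightarrow> i < n \<Longrightarrow> k < n \<Longrightarrow> cnj (B i k) = B k i"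
  unfolding herm_def by metis

lemma form_cnj: "herm n B \<Longrightarrow> cnj (form n B u v) = form n B v u"
  unfolding form_def cnj_sum
  by (subst sum.swap) (auto simp: herm_cnj intro!: sum.cong)

lemma form_combination:
  assumes "herm n B"
  shows "Re (form n B (\<lambda>i. x * u i + y * v i) (\<lambda>i. x * u i + y * v i)) =
    (cmod x)\<^sup>2 * Re (form n B u u) + (cmod y)\<^sup>2 * Re (form n B v v) + 2 * Re (cnj x * y * form n B u v)"
proof -
  define t where "t = cnj x * y * form n B u v"
  have "form n B (\<lambda>i. x * u i + y * v i) (\<lambda>i. x * u i + y * v i) =
      cnj x * x * form n B u u + cnj y * y * form n B v v + t + cnj y * x * form n B v u"
    unfolding form_def t_def sum_distrib_left sum.distrib[symmetric]
    by (intro sum.cong refl) (simp add: algebra_simps)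
  also have "cnj y * x * form n B v u = cnj t"
    using form_cnj[OF assms, of u v] by (simp add: t_def)
  also have "cnj x * x = complex_of_real ((cmod x)\<^sup>2)"
    by (metis complex_norm_square mult.commute)
  also have "cnj y * y = complex_of_real ((cmod y)\<^sup>2)"
    by (metis complex_norm_square mult.commute)
  finally show ?thesis
    unfolding t_def[symmetric] by (simp del: of_real_power)
qed

section \<open>Peeling a rank-one term off a positive semidefinite array\<close>

definition pivot :: "arr \<Rightarrow> nat \<Rightarrow> nat \<Rightarrow> complex" where
  "pivot X j i = X i j / csqrt (X j j)"

text \<open>The Schur complement of the \<open>j\<close>-th diagonal entry, kept at full size: an
  eliminated column becomes zero instead of being cut off.\<close>

definition deflate :: "arr \<Rightarrow> nat \<Rightarrow> arr" where
  "deflate X j i k = X i k - pivot X j i * cnj (pivot X j k)"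

definition unit_fun :: "nat \<Rightarrow> nat \<Rightarrow> complex" where
  "unit_fun j i = (if i = j then 1 else 0)"

lemma tr_prod_deflate: "tr_prod n B X = tr_prod n B (deflate X j) + form n B (pivot X j) (pivot X j)"
  unfolding tr_prod_def form_def deflate_def sum.distrib[symmetric]
  by (intro sum.cong refl) (simp add: algebra_simps)

lemma form_unit_right: "j < n \<Longrightarrow> form n X u (unit_fun j) = (\<Sum>i<n. cnj (u i) * X i j)"
  unfolding form_def unit_fun_def by (simp add: if_distrib sum.delta cong: if_cong)

lemma form_unit_unit: "i < n \<Longrightarrow> j < n \<Longrightarrow> form n X (unit_fun i) (unit_fun j) = X i j"
  unfolding form_unit_right unit_fun_def
  by (simp add: if_distrib[of cnj] if_distrib[of "\<lambda>x. x * _"] sum.delta cong: if_cong)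

context
  fixes n :: nat and X :: arr and j :: nat
  assumes X: "psd_arr n X" and j: "j < n"
begin

lemma psd_diagonal: "X j j = complex_of_real (Re (X j j))" "0 \<le> Re (X j j)"
proof -
  have "cnj (X j j) = X j j"
    using X j herm_cnj[of n X j j] by (simp add: psd_arr_def)
  then show "X j j = complex_of_real (Re (X j j))"
    by (metis Reals_cnj_iff of_real_Re)
  show "0 \<le> Re (X j j)"
    using X form_unit_unit[OF j j, of X] by (metis psd_arr_def)
qed

text \<open>The form at \<open>u\<close> plus \<open>z\<close> times a unit vector, as a quadratic
  function of \<open>z\<close>. Two choices of \<open>z\<close> yield the treatment of zero pivots
  and the semidefiniteness of the Schur complement.\<close>

lemma psd_shift:
  "0 \<le> Re (form n X u u) + 2 * Re (z * form n X u (unit_fun j)) + (cmod z)\<^sup>2 * Re (X j j)"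
proof -
  have "0 \<le> Re (form n X (\<lambda>i. 1 * u i + z * unit_fun j i) (\<lambda>i. 1 * u i + z * unit_fun j i))"
    using X by (simp add: psd_arr_def)
  then show ?thesis
    using X j by (subst (asm) form_combination) (auto simp: psd_arr_def form_unit_unit)
qed

lemma psd_zero_diagonal:
  assumes "X j j = 0"
  shows "form n X u (unit_fun j) = 0"
proof (rule ccontr)
  define b where "b = form n X u (unit_fun j)"
  assume "form n X u (unit_fun j) \<noteq> 0"
  then have b: "0 < (cmod b)\<^sup>2" by (simp add: b_def)
  \<comment> \<open>Without the quadratic term the bound of \<open>psd_shift\<close> is affine in
    \<open>z\<close>; this \<open>s\<close> makes its value -1.\<close>
  define s where "s = (Re (form n X u u) + 1) / (2 * (cmod b)\<^sup>2)"
  have "complex_of_real (- s) * cnj b * b = complex_of_real (- s * (cmod b)\<^sup>2)"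
    by (simp add: complex_norm_square mult.commute del: of_real_power)
  then have "Re (complex_of_real (- s) * cnj b * b) = - s * (cmod b)\<^sup>2"
    by (metis Re_complex_of_real)
  then have "0 \<le> Re (form n X u u) + 2 * (- s * (cmod b)\<^sup>2)"
    using psd_shift[of u "complex_of_real (- s) * cnj b"] assms by (simp add: b_def)
  then show False
    using b by (simp add: s_def)
qed

lemma form_deflate:
  "form n (deflate X j) u u = form n X u u - complex_of_real ((cmod (form n X u (unit_fun j)))\<^sup>2 / Re (X j j))"
proof -
  let ?b = "form n X u (unit_fun j)" and ?a = "Re (X j j)"
  have sq: "csqrt (X j j) = complex_of_real (sqrt ?a)"
    using psd_diagonal csqrt_of_real by metis
  have p: "(\<Sum>i<n. cnj (u i) * pivot X j i) = ?b / complex_of_real (sqrt ?a)"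
    unfolding form_unit_right[OF j] sum_divide_distrib by (simp add: pivot_def sq)
  have "form n (deflate X j) u u =
      form n X u u - (\<Sum>i<n. \<Sum>k<n. cnj (u i) * pivot X j i * cnj (cnj (u k) * pivot X j k))"
    unfolding form_def deflate_def sum_subtractf[symmetric]
    by (intro sum.cong refl) (simp add: algebra_simps)
  also have "(\<Sum>i<n. \<Sum>k<n. cnj (u i) * pivot X j i * cnj (cnj (u k) * pivot X j k)) =
      (\<Sum>i<n. cnj (u i) * pivot X j i) * cnj (\<Sum>i<n. cnj (u i) * pivot X j i)"
    unfolding cnj_sum sum_product ..
  also have "\<dots> = complex_of_real ((cmod (?b / complex_of_real (sqrt ?a)))\<^sup>2)"
    unfolding p by (rule complex_norm_square[symmetric])
  also have "(cmod (?b / complex_of_real (sqrt ?a)))\<^sup>2 = (cmod ?b)\<^sup>2 / ?a"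
    using psd_diagonal by (simp add: norm_divide power_divide)
  finally show ?thesis .
qed

lemma psd_deflate: "psd_arr n (deflate X j)"
  unfolding psd_arr_def
proof (intro conjI allI)
  show "herm n (deflate X j)"
    unfolding herm_def deflate_def
    using X herm_cnj[of n X] by (auto simp: psd_arr_def)
  fix u
  let ?b = "form n X u (unit_fun j)" and ?a = "Re (X j j)"
  show "0 \<le> Re (form n (deflate X j) u u)"
  proof (cases "?a = 0")
    case True
    then show ?thesis
      using X by (simp add: form_deflate psd_arr_def)
  next
    case False
    \<comment> \<open>The minimiser of the quadratic in \<open>psd_shift\<close>; its minimum is the
      form of the Schur complement.\<close>
    define z where "z = - cnj ?b / complex_of_real ?a"
    have "z * ?b = complex_of_real (- (cmod ?b)\<^sup>2 / ?a)"
      by (simp add: z_def complex_norm_square mult.commute del: of_real_power)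
    then have "Re (z * ?b) = - (cmod ?b)\<^sup>2 / ?a"
      by (metis Re_complex_of_real)
    moreover have "(cmod z)\<^sup>2 * ?a = (cmod ?b)\<^sup>2 / ?a"
      using False by (simp add: z_def norm_divide power_divide power2_eq_square)
    ultimately show ?thesis
      using psd_shift[of u z] by (simp add: form_deflate)
  qed
qed

text \<open>If the pivot is zero, nothing is subtracted, but then semidefiniteness has already made
  the whole column zero.\<close>

lemma deflate_pivot_column:
  assumes "i < n"
  shows "deflate X j i j = 0"
proof (cases "X j j = 0")
  case True
  then show ?thesis
    using psd_zero_diagonal[OF True, of "unit_fun i"] form_unit_unit[OF assms j, of X]
    by (simp add: deflate_def pivot_def)
next
  case False
  define a where "a = Re (X j j)"
  have a: "X j j = complex_of_real a" "0 \<le> a"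
    using psd_diagonal by (simp_all add: a_def)
  have "csqrt (X j j) * cnj (csqrt (X j j)) = X j j" "cnj (X j j) = X j j"
    unfolding a(1) csqrt_of_real[OF a(2)] using a(2)
    by (simp_all flip: of_real_mult)
  then show ?thesis
    using False by (simp add: deflate_def pivot_def field_simps)
qed

text \<open>Later rounds do not undo earlier ones: a zero column is by symmetry a zero row, so the
  new pivot vector vanishes at that index.\<close>

lemma deflate_zero_column:
  assumes "\<And>i. i < n \<Longrightarrow> X i l = 0" "l < n" "i < n"
  shows "deflate X j i l = 0"
proof -
  have "X l j = cnj (X j l)"
    using X j assms(2) herm_cnj[of n X j l] by (simp add: psd_arr_def)
  then show ?thesis
    using assms j by (simp add: deflate_def pivot_def)
qed

end

section \<open>Merging two vectors without changing three forms\<close>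

text \<open>The compression of the form to the span of \<open>u\<close> and \<open>v\<close>, in
  coordinates dual to those of \<open>lam4\<close>: \<open>dot4\<close> of the two is the sum of the
  products of corresponding matrix entries, the two off-diagonal ones making up for the factor
  1/2.\<close>

definition gram :: "nat \<Rightarrow> arr \<Rightarrow> (nat \<Rightarrow> complex) \<Rightarrow> (nat \<Rightarrow> complex) \<Rightarrow> nat \<Rightarrow> real" where
  "gram n B u v k = (if k = 0 then Re (form n B u u) else if k = 1 then Re (form n B v v)
     else if k = 2 then Re (form n B u v) else Im (form n B u v))"

text \<open>The merged value pairs the compression with I - 2D/\<open>lam4 d\<close>. Thus a kernel
  vector \<open>d\<close> preserves a constraint exactly, and a nonpositive pairing cannot lower the
  objective.\<close>

lemma form_coefs:
  assumes "herm n B" "lam4 d > 0"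
  shows "Re (form n B (\<lambda>i. coef1 d * u i + coef2 d * v i) (\<lambda>i. coef1 d * u i + coef2 d * v i)) =
    Re (form n B u u) + Re (form n B v v) - 2 / lam4 d * dot4 (gram n B u v) d"
  unfolding form_combination[OF assms(1)] coefs[OF assms(2)]
  by (simp add: dot4_def gram_def field_simps add_divide_distrib)

text \<open>A positive semidefinite matrix in the kernel of the identity form vanishes on the span of
  \<open>u\<close> and \<open>v\<close>, which rules out that neither sign of the kernel vector is usable.\<close>

lemma gram_identity_kernel:
  assumes J: "\<And>w. form n J w w = complex_of_real (\<Sum>i<n. (cmod (w i))\<^sup>2)" "herm n J"
    and B: "herm n B" and d: "lam4 d \<le> 0" and 0: "dot4 (gram n J u v) d = 0"
  shows "dot4 (gram n B u v) d = 0"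
proof -
  \<comment> \<open>\<open>p\<close>, \<open>r\<close> and \<open>y\<close> are the diagonal and the
    upper right entry of -D, which is positive semidefinite because \<open>D\<close> has no positive
    eigenvalue.\<close>
  define p r where "p = - d 0" and "r = - d 1"
  define y where "y = Complex (- d 2 / 2) (d 3 / 2)"
  define D where "D = (d 0 - d 1) * (d 0 - d 1) + d 2 * d 2 + d 3 * d 3"
  have D0: "0 \<le> D" by (simp add: D_def)
  have s: "sqrt D \<le> p + r" using d by (simp add: lam4_def p_def r_def D_def)
  then have pr0: "0 \<le> p + r" using D0 by (smt (verit) real_sqrt_ge_zero)
  have "D \<le> (p + r)\<^sup>2" using s D0 by (metis real_sqrt_le_iff real_sqrt_abs abs_of_nonneg pr0)
  moreover have y2: "(cmod y)\<^sup>2 = ((d 2)\<^sup>2 + (d 3)\<^sup>2) / 4"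
    by (simp add: y_def cmod_power2 power_divide add_divide_distrib)
  ultimately have ypr: "(cmod y)\<^sup>2 \<le> p * r"
    by (simp add: D_def p_def r_def power2_eq_square algebra_simps)
  have "0 \<le> p * r" using ypr by (smt (verit) zero_le_power2)
  then have p: "0 \<le> p" and r: "0 \<le> r"
    using pr0 by (auto simp: zero_le_mult_iff)
  \<comment> \<open>Completing the square: \<open>p\<close> times the pairing with -D combines two
    values of the form with nonnegative weights. For \<open>J\<close> a zero sum forces both terms
    to vanish, and with them the same terms of every other form.\<close>
  have pair: "Re (form n H (\<lambda>i. p * u i + y * v i) (\<lambda>i. p * u i + y * v i)) +
      (p * r - (cmod y)\<^sup>2) * Re (form n H v v) = - p * dot4 (gram n H u v) d" if "herm n H" for H
    unfolding form_combination[OF that]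
    using p by (simp add: gram_def dot4_def y_def p_def r_def algebra_simps power2_eq_square)
  have J0: "0 \<le> Re (form n J w w)" for w
    unfolding J(1) by (simp add: sum_nonneg)
  have vanish: "Re (form n B w w) = 0" if "Re (form n J w w) = 0" for w
  proof -
    have "(\<Sum>i<n. (cmod (w i))\<^sup>2) = 0" using that unfolding J(1) by simp
    then have "\<forall>i<n. w i = 0" by (subst (asm) sum_nonneg_eq_0_iff) auto
    then show ?thesis by (simp add: form_def)
  qed
  show ?thesis
  proof (cases "p = 0")
    case True
    \<comment> \<open>A zero diagonal entry of a semidefinite matrix kills the off-diagonal one, so
      only the value at \<open>v\<close> remains.\<close>
    then have "(cmod y)\<^sup>2 = 0" using ypr by (simp add: order.antisym)
    then have "d 2 = 0" "d 3 = 0" unfolding y2 by (simp_all add: add_nonneg_eq_0_iff)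
    moreover have "d 0 = 0" using True by (simp add: p_def)
    ultimately have eq: "dot4 (gram n H u v) d = - (r * Re (form n H v v))" for H
      by (simp add: dot4_def gram_def r_def)
    show ?thesis using 0 vanish[of v] unfolding eq by auto
  next
    case False
    let ?w = "\<lambda>i. p * u i + y * v i"
    have "Re (form n J ?w ?w) + (p * r - (cmod y)\<^sup>2) * Re (form n J v v) = 0"
      using pair[OF J(2)] 0 by simp
    then have "Re (form n J ?w ?w) = 0" "(p * r - (cmod y)\<^sup>2) * Re (form n J v v) = 0"
      using J0[of ?w] mult_nonneg_nonneg[of "p * r - (cmod y)\<^sup>2" "Re (form n J v v)"] J0[of v] ypr
      by linarith+
    then have "Re (form n B ?w ?w) + (p * r - (cmod y)\<^sup>2) * Re (form n B v v) = 0"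
      using vanish[of ?w] vanish[of v] by auto
    then show ?thesis using pair[OF B] False by simp
  qed
qed

definition merge_dir :: "nat \<Rightarrow> arr \<Rightarrow> arr \<Rightarrow> arr \<Rightarrow> arr \<Rightarrow> (nat \<Rightarrow> complex) \<Rightarrow> (nat \<Rightarrow> complex) \<Rightarrow> nat \<Rightarrow> real" where
  "merge_dir n A B1 B2 B3 u v = orient4 (gram n A u v) (kernel4 (gram n B1 u v) (gram n B2 u v) (gram n B3 u v))"

definition merge :: "nat \<Rightarrow> arr \<Rightarrow> arr \<Rightarrow> arr \<Rightarrow> arr \<Rightarrow> (nat \<Rightarrow> complex) \<Rightarrow> (nat \<Rightarrow> complex) \<Rightarrow> nat \<Rightarrow> complex" where
  "merge n A B1 B2 B3 u v i =
     coef1 (merge_dir n A B1 B2 B3 u v) * u i + coef2 (merge_dir n A B1 B2 B3 u v) * v i"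

lemma form_merge:
  fixes u v :: "nat \<Rightarrow> complex"
  assumes herm: "herm n A" "\<And>B. B \<in> {B1, B2, B3} \<Longrightarrow> herm n B"
    and J: "J \<in> {B1, B2, B3}" "\<And>w. form n J w w = complex_of_real (\<Sum>i<n. (cmod (w i))\<^sup>2)"
  defines "w \<equiv> merge n A B1 B2 B3 u v"
  shows "B \<in> {B1, B2, B3} \<Longrightarrow> Re (form n B w w) = Re (form n B u u) + Re (form n B v v)"
    and "Re (form n A w w) \<ge> Re (form n A u u) + Re (form n A v v)"
proof -
  define k where "k = kernel4 (gram n B1 u v) (gram n B2 u v) (gram n B3 u v)"
  define d where "d = merge_dir n A B1 B2 B3 u v"
  have orth: "dot4 (gram n B u v) k = 0" if "B \<in> {B1, B2, B3}" for B
    using that kernel4_orth by (auto simp: k_def dot4_commute[of "gram n _ u v"])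
  \<comment> \<open>The premise of \<open>orient4\<close>: both signs of \<open>k\<close> satisfy
    the equation of the identity form \<open>J\<close>, so \<open>gram_identity_kernel\<close>
    applies to either.\<close>
  have "dot4 (gram n A u v) e = 0" if "e \<in> {k, neg4 k}" "lam4 e \<le> 0" for e
  proof (rule gram_identity_kernel[OF J(2) herm(2)[OF J(1)] herm(1) that(2)])
    show "dot4 (gram n J u v) e = 0" using that(1) orth[OF J(1)] by auto
  qed
  note or = orient4[OF kernel4_nonzero[of "gram n B1 u v" "gram n B2 u v" "gram n B3 u v", folded k_def] this]
  have d: "d = orient4 (gram n A u v) k" by (simp add: d_def merge_dir_def k_def)
  have lam: "lam4 d > 0" and A: "dot4 (gram n A u v) d \<le> 0" and dk: "d \<in> {k, neg4 k}"
    unfolding d using or by auto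
  have w: "w = (\<lambda>i. coef1 d * u i + coef2 d * v i)"
    by (simp add: w_def merge_def d_def fun_eq_iff)
  show "Re (form n B w w) = Re (form n B u u) + Re (form n B v v)" if "B \<in> {B1, B2, B3}"
    unfolding w form_coefs[OF herm(2)[OF that] lam] using dk orth[OF that] by auto
  have "2 / lam4 d * dot4 (gram n A u v) d \<le> 0"
    using lam A by (intro mult_nonneg_nonpos) simp_all
  then show "Re (form n A w w) \<ge> Re (form n A u u) + Re (form n A v v)"
    unfolding w form_coefs[OF herm(1) lam] by linarith
qed

section \<open>Expressions for the merging coefficients\<close>

text \<open>The values have to be real, since \<open>cpos\<close> detects signs of real values
  only.\<close>

definition represents :: "state \<Rightarrow> (nat \<Rightarrow> cexp) \<Rightarrow> (nat \<Rightarrow> real) \<Rightarrow> bool" where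
  "represents s u U \<longleftrightarrow> (\<forall>k. cval (u k) s = complex_of_real (U k))"

definition cdot4 :: "(nat \<Rightarrow> cexp) \<Rightarrow> (nat \<Rightarrow> cexp) \<Rightarrow> cexp" where
  "cdot4 u v = CAdd (CAdd (CAdd (CMul (u 0) (v 0)) (CMul (u 1) (v 1))) (CMul (u 2) (v 2))) (CMul (u 3) (v 3))"

definition crej :: "(nat \<Rightarrow> cexp) \<Rightarrow> (nat \<Rightarrow> cexp) \<Rightarrow> nat \<Rightarrow> cexp" where
  "crej q x k = CSub (x k) (CMul (CDiv (cdot4 x q) (cdot4 q q)) (q k))"

definition cunit4 :: "nat \<Rightarrow> nat \<Rightarrow> cexp" where
  "cunit4 j k = CNum (if k = j then 1 else 0)"

definition cproj4 :: "(nat \<Rightarrow> cexp) \<Rightarrow> (nat \<Rightarrow> cexp) \<Rightarrow> (nat \<Rightarrow> cexp) \<Rightarrow> nat \<Rightarrow> nat \<Rightarrow> cexp" where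
  "cproj4 a b c j = crej (crej (crej a b) (crej a c)) (crej (crej a b) (crej a (cunit4 j)))"

definition csel4 :: "(nat \<Rightarrow> cexp) \<Rightarrow> (nat \<Rightarrow> cexp) \<Rightarrow> nat \<Rightarrow> cexp" where
  "csel4 x y k = cite (cdot4 x x) (x k) (y k)"

definition ckernel4 :: "(nat \<Rightarrow> cexp) \<Rightarrow> (nat \<Rightarrow> cexp) \<Rightarrow> (nat \<Rightarrow> cexp) \<Rightarrow> nat \<Rightarrow> cexp" where
  "ckernel4 a b c = csel4 (cproj4 a b c 0) (csel4 (cproj4 a b c 1) (csel4 (cproj4 a b c 2) (cproj4 a b c 3)))"

definition clam4 :: "(nat \<Rightarrow> cexp) \<Rightarrow> cexp" where
  "clam4 d = CAdd (CAdd (d 0) (d 1)) (CSqrt (CAdd (CAdd (CMul (CSub (d 0) (d 1)) (CSub (d 0) (d 1)))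
     (CMul (d 2) (d 2))) (CMul (d 3) (d 3))))"

definition corient4 :: "(nat \<Rightarrow> cexp) \<Rightarrow> (nat \<Rightarrow> cexp) \<Rightarrow> nat \<Rightarrow> cexp" where
  "corient4 r d k = cite (cpos (cdot4 r d)) (cneg (d k)) (cite (cpos (clam4 d)) (d k) (cneg (d k)))"

definition ccoef1 :: "(nat \<Rightarrow> cexp) \<Rightarrow> cexp" where
  "ccoef1 d = CSqrt (CSub (CNum 1) (CDiv (CMul (CNum 2) (d 0)) (clam4 d)))"

definition ccoef2 :: "(nat \<Rightarrow> cexp) \<Rightarrow> cexp" where
  "ccoef2 d = cite (ccoef1 d)
     (CDiv (CSub (CMul CImag (CDiv (d 3) (clam4 d))) (CDiv (d 2) (clam4 d))) (ccoef1 d))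
     (CSqrt (CSub (CNum 1) (CDiv (CMul (CNum 2) (d 1)) (clam4 d))))"

lemma cval_cdot4:
  "represents s u U \<Longrightarrow> represents s v V \<Longrightarrow> cval (cdot4 u v) s = complex_of_real (dot4 U V)"
  by (simp add: represents_def cdot4_def dot4_def)

lemma represents_crej: "represents s q Q \<Longrightarrow> represents s x X \<Longrightarrow> represents s (crej q x) (rej Q X)"
  by (auto simp: represents_def[of s "crej q x"] crej_def rej_def cval_cdot4) (simp add: represents_def)

lemma represents_cunit4: "represents s (cunit4 j) (unit4 j)"
  by (simp add: represents_def cunit4_def unit4_def)

lemma represents_cproj4:
  "represents s a A \<Longrightarrow> represents s b B \<Longrightarrow> represents s c C \<Longrightarrow>
   represents s (cproj4 a b c j) (proj4 A B C j)"
  unfolding cproj4_def proj4_def by (intro represents_crej represents_cunit4)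

lemma represents_csel4: "represents s x X \<Longrightarrow> represents s y Y \<Longrightarrow> represents s (csel4 x y) (sel4 X Y)"
  by (auto simp: represents_def[of s "csel4 x y"] csel4_def sel4_def cval_cdot4) (simp_all add: represents_def)

lemma represents_ckernel4:
  "represents s a A \<Longrightarrow> represents s b B \<Longrightarrow> represents s c C \<Longrightarrow>
   represents s (ckernel4 a b c) (kernel4 A B C)"
  unfolding ckernel4_def kernel4_def by (intro represents_csel4 represents_cproj4)

lemma cval_clam4:
  assumes "represents s d D"
  shows "cval (clam4 d) s = complex_of_real (lam4 D)"
proof -
  define r where "r = (D 0 - D 1) * (D 0 - D 1) + D 2 * D 2 + D 3 * D 3"
  have "0 \<le> r" by (simp add: r_def)
  then have "csqrt (complex_of_real r) = complex_of_real (sqrt r)" by (rule csqrt_of_real)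
  moreover have "cval (clam4 d) s = complex_of_real (D 0 + D 1) + csqrt (complex_of_real r)"
    using assms by (simp add: clam4_def represents_def r_def)
  ultimately show ?thesis by (simp add: lam4_def r_def)
qed

lemma represents_corient4:
  assumes "represents s r R" "represents s d D"
  shows "represents s (corient4 r d) (orient4 R D)"
proof -
  note [simp] = cval_cpos[OF cval_cdot4[OF assms]] cval_cpos[OF cval_clam4[OF assms(2)]]
  show ?thesis
    using assms(2) by (simp add: represents_def corient4_def orient4_def neg4_def)
qed

lemma cval_ccoef1: "represents s d D \<Longrightarrow> cval (ccoef1 d) s = coef1 D"
  by (simp add: ccoef1_def coef1_def cval_clam4) (simp add: represents_def)

lemma cval_ccoef2: "represents s d D \<Longrightarrow> cval (ccoef2 d) s = coef2 D"
  by (simp add: ccoef2_def coef2_def cval_clam4 cval_ccoef1) (simp add: represents_def)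

section \<open>The rounding program\<close>

text \<open>Array 7 holds the vector peeled off the relaxed solution. In array 8, row \<open>b\<close> holds the
  values at \<open>(w, w)\<close>, \<open>(w, v)\<close> and \<open>(v, v)\<close> of the form in array \<open>b\<close>, where \<open>w\<close> is the current
  output vector and \<open>v\<close> the peeled one. The three constraint matrices are in arrays 4 to 6, the
  identity being at \<open>4 + K\<close>; for \<open>K = 1\<close> array 6 is zero, a vacuous third constraint.\<close>

definition pivot_prog :: com where
  "pivot_prog = For 3 (Store (INum 7) (IVar 3) (INum 0)
     (CDiv (CLoad (INum 2) (IVar 3) (IVar 2)) (CSqrt (CLoad (INum 2) (IVar 2) (IVar 2)))))"

definition deflate_prog :: com where
  "deflate_prog = For 3 (For 4 (Store (INum 2) (IVar 3) (IVar 4)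
     (CSub (CLoad (INum 2) (IVar 3) (IVar 4))
       (CMul (CLoad (INum 7) (IVar 3) (INum 0)) (CCnj (CLoad (INum 7) (IVar 4) (INum 0)))))))"

definition form_prog :: "nat \<Rightarrow> nat \<Rightarrow> nat \<Rightarrow> nat \<Rightarrow> com" where
  "form_prog b u v c = Seq (Store (INum 8) (INum b) (INum c) (CNum 0))
     (For 3 (For 4 (Store (INum 8) (INum b) (INum c)
       (CAdd (CLoad (INum 8) (INum b) (INum c))
         (CMul (CMul (CCnj (CLoad (INum u) (IVar 3) (INum 0))) (CLoad (INum b) (IVar 3) (IVar 4)))
           (CLoad (INum v) (IVar 4) (INum 0)))))))"

definition gram_prog :: "nat \<Rightarrow> com" where
  "gram_prog b = Seq (form_prog b 3 3 0) (Seq (form_prog b 3 7 1) (form_prog b 7 7 2))"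

definition cgram :: "nat \<Rightarrow> nat \<Rightarrow> cexp" where
  "cgram b k = (if k = 0 then cre (CLoad (INum 8) (INum b) (INum 0))
     else if k = 1 then cre (CLoad (INum 8) (INum b) (INum 2))
     else if k = 2 then cre (CLoad (INum 8) (INum b) (INum 1))
     else cim (CLoad (INum 8) (INum b) (INum 1)))"

definition cdir :: "nat \<Rightarrow> cexp" where
  "cdir = corient4 (cgram 0) (ckernel4 (cgram 4) (cgram 5) (cgram 6))"

text \<open>The coefficient expressions are evaluated afresh for every entry. Their size does not
  depend on \<open>M\<close>, so a round still has constant cost.\<close>

definition merge_prog :: com where
  "merge_prog = For 3 (Store (INum 3) (IVar 3) (INum 0)
     (CAdd (CMul (ccoef1 cdir) (CLoad (INum 3) (IVar 3) (INum 0)))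
       (CMul (ccoef2 cdir) (CLoad (INum 7) (IVar 3) (INum 0)))))"

definition rounding_prog :: com where
  "rounding_prog = For 2 (Seq pivot_prog (Seq deflate_prog
     (Seq (gram_prog 0) (Seq (gram_prog 4) (Seq (gram_prog 5) (Seq (gram_prog 6) merge_prog))))))"

definition acol :: "store \<Rightarrow> nat \<Rightarrow> nat \<Rightarrow> complex" where
  "acol \<mu> a i = \<mu> a i 0"

section \<open>Correctness of the single passes over the arrays\<close>

lemma runs_pivot_prog:
  assumes "\<sigma> 0 = n" "\<sigma> 2 = j"
  shows "runs orc n S 3 pivot_prog \<sigma> \<mu>
    (\<lambda>\<mu>'. (\<forall>a. a \<noteq> 7 \<longrightarrow> \<mu>' a = \<mu> a) \<and> (\<forall>i<n. acol \<mu>' 7 i = pivot (\<mu> 2) j i))"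
  unfolding pivot_prog_def
proof (rule runs_For)
  fix k \<sigma>' \<mu>'
  assume "\<forall>y<3. \<sigma>' y = \<sigma> y" "\<sigma>' 3 = k"
    and "(\<forall>a. a \<noteq> 7 \<longrightarrow> \<mu>' a = \<mu> a) \<and> (\<forall>i<k. acol \<mu>' 7 i = pivot (\<mu> 2) j i)"
  then show "runs orc n S (Suc 3) (Store (INum 7) (IVar 3) (INum 0)
     (CDiv (CLoad (INum 2) (IVar 3) (IVar 2)) (CSqrt (CLoad (INum 2) (IVar 2) (IVar 2))))) \<sigma>' \<mu>'
     (\<lambda>\<mu>'. (\<forall>a. a \<noteq> 7 \<longrightarrow> \<mu>' a = \<mu> a) \<and> (\<forall>i<Suc k. acol \<mu>' 7 i = pivot (\<mu> 2) j i))"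
    using assms by (intro runs_Store) (auto simp: acol_def pivot_def less_Suc_eq)
qed (use assms in auto)

lemma runs_deflate_prog:
  assumes "\<sigma> 0 = n"
  shows "runs orc n S 3 deflate_prog \<sigma> \<mu> (\<lambda>\<mu>'. (\<forall>a. a \<noteq> 2 \<longrightarrow> \<mu>' a = \<mu> a) \<and>
    (\<forall>i<n. \<forall>k<n. \<mu>' 2 i k = \<mu> 2 i k - acol \<mu> 7 i * cnj (acol \<mu> 7 k)))"
proof -
  define new where "new i k = \<mu> 2 i k - acol \<mu> 7 i * cnj (acol \<mu> 7 k)" for i k
  \<comment> \<open>Progress in row-major order. Updating in place is safe because a new entry
    depends only on its own old value and on array 7.\<close>
  define I where "I i0 k0 \<mu>' \<longleftrightarrow> (\<forall>a. a \<noteq> 2 \<longrightarrow> \<mu>' a = \<mu> a) \<and>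
    (\<forall>i k. \<mu>' 2 i k = (if k < n \<and> i < i0 \<or> i = i0 \<and> k < k0 then new i k else \<mu> 2 i k))"
    for i0 k0 and \<mu>' :: store
  have "runs orc n S 3 deflate_prog \<sigma> \<mu> (I n 0)"
    unfolding deflate_prog_def
  proof (rule runs_For)
    fix i0 \<sigma>1 \<mu>1
    assume 1: "i0 < n" "\<forall>y<3. \<sigma>1 y = \<sigma> y" "\<sigma>1 3 = i0" "I i0 0 \<mu>1"
    let ?c = "Store (INum 2) (IVar 3) (IVar 4)
     (CSub (CLoad (INum 2) (IVar 3) (IVar 4))
       (CMul (CLoad (INum 7) (IVar 3) (INum 0)) (CCnj (CLoad (INum 7) (IVar 4) (INum 0)))))"
    have "runs orc n S 4 (For 4 ?c) \<sigma>1 \<mu>1 (I i0 n)"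
    proof (rule runs_For)
      fix k0 \<sigma>2 \<mu>2
      assume 2: "k0 < n" "\<forall>y<4. \<sigma>2 y = \<sigma>1 y" "\<sigma>2 4 = k0" "I i0 k0 \<mu>2"
      show "runs orc n S (Suc 4) ?c \<sigma>2 \<mu>2 (I i0 (Suc k0))"
        using 1 2 unfolding I_def by (intro runs_Store) (auto simp: new_def acol_def less_Suc_eq)
    qed (use 1 assms in auto)
    \<comment> \<open>A completed row \<open>i0\<close> is the same state of progress as an
      untouched row \<open>Suc i0\<close>.\<close>
    then have "runs orc n S 4 (For 4 ?c) \<sigma>1 \<mu>1 (I (Suc i0) 0)"
      by (rule runs_weaken) (auto simp: I_def less_Suc_eq)
    then show "runs orc n S (Suc 3) (For 4 ?c) \<sigma>1 \<mu>1 (I (Suc i0) 0)"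
      by simp
  qed (use assms in \<open>auto simp: I_def\<close>)
  then show ?thesis
    by (rule runs_weaken) (auto simp: I_def new_def)
qed

definition put :: "nat \<Rightarrow> nat \<Rightarrow> nat \<Rightarrow> complex \<Rightarrow> store \<Rightarrow> store" where
  "put a i j z \<mu> = \<mu>(a := (\<mu> a)(i := (\<mu> a i)(j := z)))"

lemma put_put: "put a i j z (put a i j y \<mu>) = put a i j z \<mu>"
  by (auto simp: put_def fun_eq_iff)

lemma runs_put:
  assumes "R (put (ival a \<sigma>) (ival i \<sigma>) (ival j \<sigma>) (cval e (\<sigma>, \<mu>)) \<mu>)"
  shows "runs orc n S x (Store a i j e) \<sigma> \<mu> R"
  using assms unfolding put_def by (rule runs_Store)

lemma runs_form_prog:
  assumes "\<sigma> 0 = n" "b \<noteq> 8" "u \<noteq> 8" "v \<noteq> 8"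
  shows "runs orc n S 3 (form_prog b u v c) \<sigma> \<mu>
    (\<lambda>\<mu>'. \<mu>' = put 8 b c (form n (\<mu> b) (acol \<mu> u) (acol \<mu> v)) \<mu>)"
proof -
  define t where "t i k = cnj (acol \<mu> u i) * \<mu> b i k * acol \<mu> v k" for i k
  \<comment> \<open>The invariant is a store rather than a predicate: only the accumulator cell
    changes, so the intermediate store is known exactly.\<close>
  define I where "I i0 k0 = put 8 b c ((\<Sum>i<i0. \<Sum>k<n. t i k) + (\<Sum>k<k0. t i0 k)) \<mu>" for i0 k0
  define d where "d = Store (INum 8) (INum b) (INum c)
       (CAdd (CLoad (INum 8) (INum b) (INum c))
         (CMul (CMul (CCnj (CLoad (INum u) (IVar 3) (INum 0))) (CLoad (INum b) (IVar 3) (IVar 4)))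
           (CLoad (INum v) (IVar 4) (INum 0))))"
  have loop: "runs orc n S 3 (For 3 (For 4 d)) \<sigma>' \<mu>' (\<lambda>\<mu>'. \<mu>' = I n 0)"
    if "\<forall>y<3. \<sigma>' y = \<sigma> y" "\<mu>' = I 0 0" for \<sigma>' \<mu>'
  proof (rule runs_For)
    fix i0 \<sigma>1 \<mu>1
    assume 1: "i0 < n" "\<forall>y<3. \<sigma>1 y = \<sigma>' y" "\<sigma>1 3 = i0" "\<mu>1 = I i0 0"
    have "runs orc n S 4 (For 4 d) \<sigma>1 \<mu>1 (\<lambda>\<mu>'. \<mu>' = I i0 n)"
    proof (rule runs_For)
      fix k0 \<sigma>2 \<mu>2
      assume 2: "k0 < n" "\<forall>y<4. \<sigma>2 y = \<sigma>1 y" "\<sigma>2 4 = k0" "\<mu>2 = I i0 k0"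
      have "\<sigma>2 3 = i0" using 1 2 by simp
      then have "cval (CAdd (CLoad (INum 8) (INum b) (INum c))
         (CMul (CMul (CCnj (CLoad (INum u) (IVar 3) (INum 0))) (CLoad (INum b) (IVar 3) (IVar 4)))
           (CLoad (INum v) (IVar 4) (INum 0)))) (\<sigma>2, I i0 k0) =
           (\<Sum>i<i0. \<Sum>k<n. t i k) + (\<Sum>k<Suc k0. t i0 k)"
        using assms 2(3) by (simp add: I_def put_def t_def acol_def)
      then show "runs orc n S (Suc 4) d \<sigma>2 \<mu>2 (\<lambda>\<mu>'. \<mu>' = I i0 (Suc k0))"
        unfolding d_def 2(4) by (intro runs_put) (simp only: ival.simps I_def put_put)
    qed (use 1 that assms in auto)
    then show "runs orc n S (Suc 3) (For 4 d) \<sigma>1 \<mu>1 (\<lambda>\<mu>'. \<mu>' = I (Suc i0) 0)"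
      by (simp add: I_def)
  qed (use that assms in auto)
  have "form n (\<mu> b) (acol \<mu> u) (acol \<mu> v) = (\<Sum>i<n. \<Sum>k<n. t i k) + (\<Sum>k<0. t n k)"
    by (simp add: form_def t_def)
  then have eq: "put 8 b c (form n (\<mu> b) (acol \<mu> u) (acol \<mu> v)) \<mu> = I n 0"
    by (simp only: I_def)
  show ?thesis
    unfolding form_prog_def d_def[symmetric] eq
  proof (rule runs_Seq[where R' = "\<lambda>\<mu>'. \<mu>' = I 0 0"])
    show "runs orc n S 3 (Store (INum 8) (INum b) (INum c) (CNum 0)) \<sigma> \<mu> (\<lambda>\<mu>'. \<mu>' = I 0 0)"
      by (rule runs_put) (simp add: I_def)
  qed (rule loop)
qed

lemma runs_gram_prog:
  assumes "\<sigma> 0 = n" "b \<noteq> 8"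
  shows "runs orc n S 3 (gram_prog b) \<sigma> \<mu> (\<lambda>\<mu>'. (\<forall>a. a \<noteq> 8 \<longrightarrow> \<mu>' a = \<mu> a) \<and>
    (\<forall>r. r \<noteq> b \<longrightarrow> \<mu>' 8 r = \<mu> 8 r) \<and> \<mu>' 8 b 0 = form n (\<mu> b) (acol \<mu> 3) (acol \<mu> 3) \<and>
    \<mu>' 8 b 1 = form n (\<mu> b) (acol \<mu> 3) (acol \<mu> 7) \<and> \<mu>' 8 b 2 = form n (\<mu> b) (acol \<mu> 7) (acol \<mu> 7))"
  unfolding gram_prog_def
proof (rule runs_Seq[OF runs_form_prog])
  fix \<sigma>1 \<mu>1
  assume 1: "\<forall>y<3. \<sigma>1 y = \<sigma> y" "\<mu>1 = put 8 b 0 (form n (\<mu> b) (acol \<mu> 3) (acol \<mu> 3)) \<mu>"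
  show "runs orc n S 3 (Seq (form_prog b 3 7 1) (form_prog b 7 7 2)) \<sigma>1 \<mu>1
     (\<lambda>\<mu>'. (\<forall>a. a \<noteq> 8 \<longrightarrow> \<mu>' a = \<mu> a) \<and>
    (\<forall>r. r \<noteq> b \<longrightarrow> \<mu>' 8 r = \<mu> 8 r) \<and> \<mu>' 8 b 0 = form n (\<mu> b) (acol \<mu> 3) (acol \<mu> 3) \<and>
    \<mu>' 8 b 1 = form n (\<mu> b) (acol \<mu> 3) (acol \<mu> 7) \<and> \<mu>' 8 b 2 = form n (\<mu> b) (acol \<mu> 7) (acol \<mu> 7))"
  proof (rule runs_Seq[OF runs_form_prog])
    fix \<sigma>2 \<mu>2
    assume 2: "\<forall>y<3. \<sigma>2 y = \<sigma>1 y" "\<mu>2 = put 8 b 1 (form n (\<mu>1 b) (acol \<mu>1 3) (acol \<mu>1 7)) \<mu>1"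
    show "runs orc n S 3 (form_prog b 7 7 2) \<sigma>2 \<mu>2
     (\<lambda>\<mu>'. (\<forall>a. a \<noteq> 8 \<longrightarrow> \<mu>' a = \<mu> a) \<and>
    (\<forall>r. r \<noteq> b \<longrightarrow> \<mu>' 8 r = \<mu> 8 r) \<and> \<mu>' 8 b 0 = form n (\<mu> b) (acol \<mu> 3) (acol \<mu> 3) \<and>
    \<mu>' 8 b 1 = form n (\<mu> b) (acol \<mu> 3) (acol \<mu> 7) \<and> \<mu>' 8 b 2 = form n (\<mu> b) (acol \<mu> 7) (acol \<mu> 7))"
    proof (rule runs_weaken[OF runs_form_prog])
      have [simp]: "acol \<mu>1 3 = acol \<mu> 3" "acol \<mu>1 7 = acol \<mu> 7" "\<mu>1 b = \<mu> b"
        "acol \<mu>2 7 = acol \<mu> 7" "\<mu>2 b = \<mu> b"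
        using assms by (auto simp: 1 2 put_def acol_def fun_eq_iff)
      fix \<mu>' assume "\<mu>' = put 8 b 2 (form n (\<mu>2 b) (acol \<mu>2 7) (acol \<mu>2 7)) \<mu>2"
      then have "\<mu>' = put 8 b 2 (form n (\<mu> b) (acol \<mu> 7) (acol \<mu> 7)) \<mu>2"
        by simp
      moreover have "\<mu>2 = put 8 b 1 (form n (\<mu> b) (acol \<mu> 3) (acol \<mu> 7)) \<mu>1"
        unfolding 2(2) by simp
      ultimately have "\<mu>' = put 8 b 2 (form n (\<mu> b) (acol \<mu> 7) (acol \<mu> 7))
         (put 8 b 1 (form n (\<mu> b) (acol \<mu> 3) (acol \<mu> 7)) (put 8 b 0 (form n (\<mu> b) (acol \<mu> 3) (acol \<mu> 3)) \<mu>))"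
        by (simp only: 1(2))
      then show "(\<forall>a. a \<noteq> 8 \<longrightarrow> \<mu>' a = \<mu> a) \<and>
        (\<forall>r. r \<noteq> b \<longrightarrow> \<mu>' 8 r = \<mu> 8 r) \<and> \<mu>' 8 b 0 = form n (\<mu> b) (acol \<mu> 3) (acol \<mu> 3) \<and>
        \<mu>' 8 b 1 = form n (\<mu> b) (acol \<mu> 3) (acol \<mu> 7) \<and> \<mu>' 8 b 2 = form n (\<mu> b) (acol \<mu> 7) (acol \<mu> 7)"
        by (simp add: put_def)
    qed (use 1 2 assms in auto)
  qed (use 1 assms in auto)
qed (use assms in auto)

text \<open>The programs fix arrays only at indices below \<open>n\<close>; this and the next two
  rules show that nothing else is read.\<close>

lemma form_cong:
  "(\<And>i. i < n \<Longrightarrow> u i = u' i) \<Longrightarrow> (\<And>i. i < n \<Longrightarrow> v i = v' i) \<Longrightarrow> form n B u v = form n B u' v'"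
  unfolding form_def by (auto intro!: sum.cong)

lemma tr_prod_cong:
  "(\<And>i k. i < n \<Longrightarrow> k < n \<Longrightarrow> X i k = X' i k) \<Longrightarrow> tr_prod n B X = tr_prod n B X'"
  unfolding tr_prod_def by (auto intro!: sum.cong)

lemma psd_arr_cong:
  assumes "\<And>i k. i < n \<Longrightarrow> k < n \<Longrightarrow> X i k = X' i k"
  shows "psd_arr n X \<longleftrightarrow> psd_arr n X'"
proof -
  have "form n X u u = form n X' u u" for u
    unfolding form_def using assms by (auto intro!: sum.cong)
  moreover have "herm n X \<longleftrightarrow> herm n X'"
    unfolding herm_def by (simp add: assms)
  ultimately show ?thesis
    by (simp add: psd_arr_def)
qed

lemma runs_merge_prog:
  assumes "\<sigma> 0 = n"
    and gram: "\<And>b. b \<in> {0, 4, 5, 6} \<Longrightarrow> \<mu> 8 b 0 = form n (\<mu> b) u u \<and> \<mu> 8 b 1 = form n (\<mu> b) u v \<and>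
      \<mu> 8 b 2 = form n (\<mu> b) v v"
    and u: "u = acol \<mu> 3" and v: "v = acol \<mu> 7"
  shows "runs orc n S 3 merge_prog \<sigma> \<mu> (\<lambda>\<mu>'. (\<forall>a. a \<noteq> 3 \<longrightarrow> \<mu>' a = \<mu> a) \<and>
    (\<forall>i<n. acol \<mu>' 3 i = merge n (\<mu> 0) (\<mu> 4) (\<mu> 5) (\<mu> 6) u v i))"
proof -
  define d where "d = merge_dir n (\<mu> 0) (\<mu> 4) (\<mu> 5) (\<mu> 6) u v"
  \<comment> \<open>Stated for every state that agrees on array 8, since the loop overwrites
    \<open>w\<close> in array 3 while it goes on evaluating the coefficients.\<close>
  have rep: "represents s cdir d" if "snd s 8 = \<mu> 8" for s
  proof -
    have "represents s (cgram b) (gram n (\<mu> b) u v)" if "b \<in> {0, 4, 5, 6}" for b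
      using gram[OF that] \<open>snd s 8 = \<mu> 8\<close> by (simp add: represents_def cgram_def gram_def)
    then show ?thesis
      unfolding cdir_def d_def merge_dir_def by (intro represents_corient4 represents_ckernel4) auto
  qed
  define I where "I k \<mu>' \<longleftrightarrow> (\<forall>a. a \<noteq> 3 \<longrightarrow> \<mu>' a = \<mu> a) \<and>
    (\<forall>i. acol \<mu>' 3 i = (if i < k then coef1 d * u i + coef2 d * v i else u i))" for k and \<mu>' :: store
  have "runs orc n S 3 merge_prog \<sigma> \<mu> (I n)"
    unfolding merge_prog_def
  proof (rule runs_For)
    fix k \<sigma>' \<mu>'
    let ?e = "CAdd (CMul (ccoef1 cdir) (CLoad (INum 3) (IVar 3) (INum 0)))
       (CMul (ccoef2 cdir) (CLoad (INum 7) (IVar 3) (INum 0)))"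
    assume k: "k < n" "\<forall>y<3. \<sigma>' y = \<sigma> y" "\<sigma>' 3 = k" "I k \<mu>'"
    have rep': "represents (\<sigma>', \<mu>') cdir d"
      by (rule rep) (use k(4) in \<open>simp add: I_def\<close>)
    have "\<mu>' 3 k 0 = u k" "\<mu>' 7 k 0 = v k"
      using k(4) by (auto simp: I_def acol_def v)
    then have "cval ?e (\<sigma>', \<mu>') = coef1 d * u k + coef2 d * v k"
      using k(3) by (simp add: cval_ccoef1[OF rep'] cval_ccoef2[OF rep'])
    then show "runs orc n S (Suc 3) (Store (INum 3) (IVar 3) (INum 0) ?e) \<sigma>' \<mu>' (I (Suc k))"
      using k by (intro runs_put) (simp only: ival.simps, auto simp: I_def put_def acol_def less_Suc_eq)
  qed (use assms in \<open>auto simp: I_def\<close>)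
  then show ?thesis
    by (rule runs_weaken) (auto simp: I_def merge_def d_def)
qed

lemma runs_gram_merge:
  assumes "\<sigma> 0 = n"
  shows "runs orc n S 3 (Seq (gram_prog 0) (Seq (gram_prog 4) (Seq (gram_prog 5) (Seq (gram_prog 6) merge_prog))))
    \<sigma> \<mu> (\<lambda>\<mu>'. (\<forall>a. a \<notin> {3, 8} \<longrightarrow> \<mu>' a = \<mu> a) \<and>
    (\<forall>i<n. acol \<mu>' 3 i = merge n (\<mu> 0) (\<mu> 4) (\<mu> 5) (\<mu> 6) (acol \<mu> 3) (acol \<mu> 7) i))"
proof -
  have ac: "acol \<mu>' 3 = acol \<mu> 3 \<and> acol \<mu>' 7 = acol \<mu> 7" if "\<forall>a. a \<noteq> 8 \<longrightarrow> \<mu>' a = \<mu> a" for \<mu>' :: store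
    using that by (auto simp: acol_def fun_eq_iff)
  \<comment> \<open>\<open>bs\<close> is the set of rows of array 8 that are already filled.\<close>
  define G where "G bs \<mu>' \<longleftrightarrow> (\<forall>a. a \<noteq> 8 \<longrightarrow> \<mu>' a = \<mu> a) \<and>
    (\<forall>b\<in>bs. \<mu>' 8 b 0 = form n (\<mu> b) (acol \<mu> 3) (acol \<mu> 3) \<and> \<mu>' 8 b 1 = form n (\<mu> b) (acol \<mu> 3) (acol \<mu> 7) \<and>
      \<mu>' 8 b 2 = form n (\<mu> b) (acol \<mu> 7) (acol \<mu> 7))" for bs and \<mu>' :: store
  have step: "runs orc n S 3 (gram_prog b) \<sigma>' \<mu>' (G (insert b bs))"
    if "\<forall>y<3. \<sigma>' y = \<sigma> y" "G bs \<mu>'" "b \<noteq> 8" for \<sigma>' \<mu>' b bs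
  proof (rule runs_weaken[OF runs_gram_prog])
    fix \<mu>''
    assume R: "(\<forall>a. a \<noteq> 8 \<longrightarrow> \<mu>'' a = \<mu>' a) \<and> (\<forall>r. r \<noteq> b \<longrightarrow> \<mu>'' 8 r = \<mu>' 8 r) \<and>
      \<mu>'' 8 b 0 = form n (\<mu>' b) (acol \<mu>' 3) (acol \<mu>' 3) \<and>
      \<mu>'' 8 b 1 = form n (\<mu>' b) (acol \<mu>' 3) (acol \<mu>' 7) \<and> \<mu>'' 8 b 2 = form n (\<mu>' b) (acol \<mu>' 7) (acol \<mu>' 7)"
    have "\<mu>' b = \<mu> b" "acol \<mu>' 3 = acol \<mu> 3" "acol \<mu>' 7 = acol \<mu> 7"
      using that ac[of \<mu>'] by (auto simp: G_def)
    note new = this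
    have "\<forall>a. a \<noteq> 8 \<longrightarrow> \<mu>'' a = \<mu> a"
      using R that(2) unfolding G_def by simp
    moreover have "\<mu>'' 8 c 0 = form n (\<mu> c) (acol \<mu> 3) (acol \<mu> 3) \<and> \<mu>'' 8 c 1 = form n (\<mu> c) (acol \<mu> 3) (acol \<mu> 7) \<and>
      \<mu>'' 8 c 2 = form n (\<mu> c) (acol \<mu> 7) (acol \<mu> 7)" if "c \<in> insert b bs" for c
      using R new \<open>G bs \<mu>'\<close> that unfolding G_def by (cases "c = b") auto
    ultimately show "G (insert b bs) \<mu>''"
      unfolding G_def by blast
  qed (use that assms in auto)
  have merge: "runs orc n S 3 merge_prog \<sigma>' \<mu>' (\<lambda>\<mu>'. (\<forall>a. a \<notin> {3, 8} \<longrightarrow> \<mu>' a = \<mu> a) \<and>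
    (\<forall>i<n. acol \<mu>' 3 i = merge n (\<mu> 0) (\<mu> 4) (\<mu> 5) (\<mu> 6) (acol \<mu> 3) (acol \<mu> 7) i))"
    if "\<forall>y<3. \<sigma>' y = \<sigma> y" "G {6, 5, 4, 0} \<mu>'" for \<sigma>' \<mu>'
  proof (rule runs_weaken[OF runs_merge_prog])
    have arr: "\<forall>a. a \<noteq> 8 \<longrightarrow> \<mu>' a = \<mu> a"
      using that(2) unfolding G_def by (rule conjunct1)
    have b: "\<mu>' b = \<mu> b" if "b \<in> {0, 4, 5, 6}" for b
      using arr that by auto
    show "\<sigma>' 0 = n" using that(1) assms by simp
    show "acol \<mu> 3 = acol \<mu>' 3" "acol \<mu> 7 = acol \<mu>' 7"
      using ac[OF arr] by simp_all
    show "\<mu>' 8 b 0 = form n (\<mu>' b) (acol \<mu> 3) (acol \<mu> 3) \<and> \<mu>' 8 b 1 = form n (\<mu>' b) (acol \<mu> 3) (acol \<mu> 7) \<and>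
      \<mu>' 8 b 2 = form n (\<mu>' b) (acol \<mu> 7) (acol \<mu> 7)" if "b \<in> {0, 4, 5, 6}" for b
      using that b[OF that] \<open>G {6, 5, 4, 0} \<mu>'\<close> unfolding G_def by auto
    fix \<mu>''
    assume "(\<forall>a. a \<noteq> 3 \<longrightarrow> \<mu>'' a = \<mu>' a) \<and>
      (\<forall>i<n. acol \<mu>'' 3 i = merge n (\<mu>' 0) (\<mu>' 4) (\<mu>' 5) (\<mu>' 6) (acol \<mu> 3) (acol \<mu> 7) i)"
    then show "(\<forall>a. a \<notin> {3, 8} \<longrightarrow> \<mu>'' a = \<mu> a) \<and>
      (\<forall>i<n. acol \<mu>'' 3 i = merge n (\<mu> 0) (\<mu> 4) (\<mu> 5) (\<mu> 6) (acol \<mu> 3) (acol \<mu> 7) i)"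
      using arr b by simp
  qed
  show ?thesis
  proof (rule runs_Seq[OF step[of _ "{}"]])
    show "G {} \<mu>" by (simp add: G_def)
    fix \<sigma>1 \<mu>1 assume 1: "\<forall>y<3. \<sigma>1 y = \<sigma> y" "G {0} \<mu>1"
    show "runs orc n S 3 (Seq (gram_prog 4) (Seq (gram_prog 5) (Seq (gram_prog 6) merge_prog))) \<sigma>1 \<mu>1
       (\<lambda>\<mu>'. (\<forall>a. a \<notin> {3, 8} \<longrightarrow> \<mu>' a = \<mu> a) \<and>
      (\<forall>i<n. acol \<mu>' 3 i = merge n (\<mu> 0) (\<mu> 4) (\<mu> 5) (\<mu> 6) (acol \<mu> 3) (acol \<mu> 7) i))"
    proof (rule runs_Seq[OF step[OF 1]])
      fix \<sigma>2 \<mu>2 assume 2: "\<forall>y<3. \<sigma>2 y = \<sigma>1 y" "G {4, 0} \<mu>2"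
      have s2: "\<forall>y<3. \<sigma>2 y = \<sigma> y" using 1 2 by simp
      show "runs orc n S 3 (Seq (gram_prog 5) (Seq (gram_prog 6) merge_prog)) \<sigma>2 \<mu>2
         (\<lambda>\<mu>'. (\<forall>a. a \<notin> {3, 8} \<longrightarrow> \<mu>' a = \<mu> a) \<and>
        (\<forall>i<n. acol \<mu>' 3 i = merge n (\<mu> 0) (\<mu> 4) (\<mu> 5) (\<mu> 6) (acol \<mu> 3) (acol \<mu> 7) i))"
      proof (rule runs_Seq[OF step[OF s2 2(2)]])
        fix \<sigma>3 \<mu>3 assume 3: "\<forall>y<3. \<sigma>3 y = \<sigma>2 y" "G {5, 4, 0} \<mu>3"
        have s3: "\<forall>y<3. \<sigma>3 y = \<sigma> y" using 3 s2 by simp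
        show "runs orc n S 3 (Seq (gram_prog 6) merge_prog) \<sigma>3 \<mu>3
           (\<lambda>\<mu>'. (\<forall>a. a \<notin> {3, 8} \<longrightarrow> \<mu>' a = \<mu> a) \<and>
          (\<forall>i<n. acol \<mu>' 3 i = merge n (\<mu> 0) (\<mu> 4) (\<mu> 5) (\<mu> 6) (acol \<mu> 3) (acol \<mu> 7) i))"
        proof (rule runs_Seq[OF step[OF s3 3(2)]])
          fix \<sigma>4 \<mu>4 assume 4: "\<forall>y<3. \<sigma>4 y = \<sigma>3 y" "G {6, 5, 4, 0} \<mu>4"
          show "runs orc n S 3 merge_prog \<sigma>4 \<mu>4
             (\<lambda>\<mu>'. (\<forall>a. a \<notin> {3, 8} \<longrightarrow> \<mu>' a = \<mu> a) \<and>
            (\<forall>i<n. acol \<mu>' 3 i = merge n (\<mu> 0) (\<mu> 4) (\<mu> 5) (\<mu> 6) (acol \<mu> 3) (acol \<mu> 7) i))"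
            by (rule merge) (use 4 s3 in auto)
        qed simp
      qed simp
    qed simp
  qed simp_all
qed

lemma runs_rounding_prog:
  assumes \<sigma>: "\<sigma> 0 = n" and herm: "\<And>b. b \<in> {0, 4, 5, 6} \<Longrightarrow> herm n (\<mu> b)"
    and j: "j \<in> {4, 5, 6}" "\<And>w. form n (\<mu> j) w w = complex_of_real (\<Sum>i<n. (cmod (w i))\<^sup>2)"
    and X: "psd_arr n (\<mu> 2)" and zero: "\<And>i. i < n \<Longrightarrow> acol \<mu> 3 i = 0"
  shows "runs orc n S 2 rounding_prog \<sigma> \<mu> (\<lambda>\<mu>'.
    (\<forall>b\<in>{4, 5, 6}. Re (form n (\<mu> b) (acol \<mu>' 3) (acol \<mu>' 3)) = Re (tr_prod n (\<mu> b) (\<mu> 2))) \<and>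
    Re (form n (\<mu> 0) (acol \<mu>' 3) (acol \<mu>' 3)) \<ge> Re (tr_prod n (\<mu> 0) (\<mu> 2)))"
proof -
  \<comment> \<open>A conservation law: what the vector in array 3 has collected and what is left in
    array 2 add up to the initial trace, with an inequality for the objective. The zero columns make
    the leftover vanish after \<open>n\<close> rounds.\<close>
  define I where "I l \<mu>' \<longleftrightarrow> (\<forall>b\<in>{0, 4, 5, 6}. \<mu>' b = \<mu> b) \<and> psd_arr n (\<mu>' 2) \<and>
    (\<forall>m<l. \<forall>i<n. \<mu>' 2 i m = 0) \<and>
    (\<forall>b\<in>{4, 5, 6}. Re (form n (\<mu> b) (acol \<mu>' 3) (acol \<mu>' 3)) + Re (tr_prod n (\<mu> b) (\<mu>' 2)) =
      Re (tr_prod n (\<mu> b) (\<mu> 2))) \<and>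
    Re (form n (\<mu> 0) (acol \<mu>' 3) (acol \<mu>' 3)) + Re (tr_prod n (\<mu> 0) (\<mu>' 2)) \<ge> Re (tr_prod n (\<mu> 0) (\<mu> 2))"
    for l and \<mu>' :: store
  have "runs orc n S 2 rounding_prog \<sigma> \<mu> (I n)"
    unfolding rounding_prog_def
  proof (rule runs_For)
    \<comment> \<open>The process starts from \<open>w = 0\<close>, so that the first peeled vector
      is merged like all others.\<close>
    show "I 0 \<mu>"
    proof -
      have "form n B (acol \<mu> 3) (acol \<mu> 3) = 0" for B
        using zero by (simp add: form_def)
      then show ?thesis using X by (simp add: I_def)
    qed
  next
    fix l \<sigma>0 \<mu>0
    assume l: "l < n" "\<forall>y<2. \<sigma>0 y = \<sigma> y" "\<sigma>0 2 = l" and I: "I l \<mu>0"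
    from I have I_arr: "\<forall>b\<in>{0, 4, 5, 6}. \<mu>0 b = \<mu> b" and X0: "psd_arr n (\<mu>0 2)"
      and I_zero: "\<forall>m<l. \<forall>i<n. \<mu>0 2 i m = 0"
      and I_eq: "\<forall>b\<in>{4, 5, 6}. Re (form n (\<mu> b) (acol \<mu>0 3) (acol \<mu>0 3)) + Re (tr_prod n (\<mu> b) (\<mu>0 2)) =
        Re (tr_prod n (\<mu> b) (\<mu> 2))"
      and I_ge: "Re (form n (\<mu> 0) (acol \<mu>0 3) (acol \<mu>0 3)) + Re (tr_prod n (\<mu> 0) (\<mu>0 2)) \<ge> Re (tr_prod n (\<mu> 0) (\<mu> 2))"
      unfolding I_def by - ((elim conjE, assumption)+)
    have b0: "\<mu>0 b = \<mu> b" if "b \<in> {0, 4, 5, 6}" for b using I_arr that by (rule bspec)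
    define Y where "Y = deflate (\<mu>0 2) l"
    have Y: "psd_arr n Y" unfolding Y_def by (rule psd_deflate[OF X0 l(1)])
    have "runs orc n S 3 (Seq pivot_prog (Seq deflate_prog
       (Seq (gram_prog 0) (Seq (gram_prog 4) (Seq (gram_prog 5) (Seq (gram_prog 6) merge_prog)))))) \<sigma>0 \<mu>0 (I (Suc l))"
    proof (rule runs_Seq)
      show "runs orc n S 3 pivot_prog \<sigma>0 \<mu>0
        (\<lambda>\<mu>'. (\<forall>a. a \<noteq> 7 \<longrightarrow> \<mu>' a = \<mu>0 a) \<and> (\<forall>i<n. acol \<mu>' 7 i = pivot (\<mu>0 2) l i))"
        by (rule runs_pivot_prog) (use l \<sigma> in auto)
      fix \<sigma>1 \<mu>1
      assume 1: "\<forall>y<3. \<sigma>1 y = \<sigma>0 y" "(\<forall>a. a \<noteq> 7 \<longrightarrow> \<mu>1 a = \<mu>0 a) \<and> (\<forall>i<n. acol \<mu>1 7 i = pivot (\<mu>0 2) l i)"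
      show "runs orc n S 3 (Seq deflate_prog
         (Seq (gram_prog 0) (Seq (gram_prog 4) (Seq (gram_prog 5) (Seq (gram_prog 6) merge_prog))))) \<sigma>1 \<mu>1 (I (Suc l))"
      proof (rule runs_Seq[OF runs_deflate_prog])
        show "\<sigma>1 0 = n" using 1 l \<sigma> by simp
        fix \<sigma>2 \<mu>2
        assume 2: "\<forall>y<3. \<sigma>2 y = \<sigma>1 y" "(\<forall>a. a \<noteq> 2 \<longrightarrow> \<mu>2 a = \<mu>1 a) \<and>
          (\<forall>i<n. \<forall>k<n. \<mu>2 2 i k = \<mu>1 2 i k - acol \<mu>1 7 i * cnj (acol \<mu>1 7 k))"
        have Y2: "\<mu>2 2 i k = Y i k" if "i < n" "k < n" for i k
          using 1(2) 2(2) that by (simp add: Y_def deflate_def)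
        have v: "acol \<mu>2 7 i = pivot (\<mu>0 2) l i" if "i < n" for i
          using 1(2) 2(2) that by (simp add: acol_def)
        have u: "acol \<mu>2 3 = acol \<mu>0 3"
          using 1(2) 2(2) by (simp add: acol_def fun_eq_iff)
        have b2: "\<mu>2 b = \<mu> b" if "b \<in> {0, 4, 5, 6}" for b
          using 1(2) 2(2) b0[OF that] that by auto
        show "runs orc n S 3 (Seq (gram_prog 0) (Seq (gram_prog 4) (Seq (gram_prog 5) (Seq (gram_prog 6) merge_prog))))
          \<sigma>2 \<mu>2 (I (Suc l))"
        proof (rule runs_weaken[OF runs_gram_merge])
          show "\<sigma>2 0 = n" using 2 1 l \<sigma> by simp
          fix \<mu>3
          let ?v = "acol \<mu>2 7"
          let ?w = "merge n (\<mu> 0) (\<mu> 4) (\<mu> 5) (\<mu> 6) (acol \<mu>0 3) ?v"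
          assume 3: "(\<forall>a. a \<notin> {3, 8} \<longrightarrow> \<mu>3 a = \<mu>2 a) \<and> (\<forall>i<n. acol \<mu>3 3 i =
            merge n (\<mu>2 0) (\<mu>2 4) (\<mu>2 5) (\<mu>2 6) (acol \<mu>2 3) (acol \<mu>2 7) i)"
          have w: "form n B (acol \<mu>3 3) (acol \<mu>3 3) = form n B ?w ?w" for B
            using 3 by (intro form_cong) (simp_all add: u b2)
          have vv: "form n B ?v ?v = form n B (pivot (\<mu>0 2) l) (pivot (\<mu>0 2) l)" for B
            by (intro form_cong v)
          have X3: "\<mu>3 2 i k = Y i k" if "i < n" "k < n" for i k
            using 3 Y2[OF that] by simp
          have tr: "Re (tr_prod n B (\<mu>0 2)) = Re (tr_prod n B (\<mu>3 2)) + Re (form n B ?v ?v)" for B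
            using tr_prod_deflate[of n B "\<mu>0 2" l] tr_prod_cong[of n "\<mu>3 2" Y B] X3
            by (simp add: Y_def vv)
          have jin: "\<mu> j \<in> {\<mu> 4, \<mu> 5, \<mu> 6}" using j(1) by auto
          have hermB: "herm n B" if "B \<in> {\<mu> 4, \<mu> 5, \<mu> 6}" for B
            using that herm by auto
          note fm = form_merge[OF herm[of 0] hermB jin j(2), where u = "acol \<mu>0 3" and v = ?v]
          show "I (Suc l) \<mu>3"
            unfolding I_def w
          proof (intro conjI)
            show "\<forall>b\<in>{0, 4, 5, 6}. \<mu>3 b = \<mu> b" using 3 b2 by simp
            show "psd_arr n (\<mu>3 2)" using Y psd_arr_cong[of n "\<mu>3 2" Y] X3 by simp
            show "\<forall>m<Suc l. \<forall>i<n. \<mu>3 2 i m = 0"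
            proof (intro allI impI)
              fix m i assume m: "m < Suc l" "i < n"
              show "\<mu>3 2 i m = 0"
              proof (cases "m = l")
                case True
                then show ?thesis using X3[of i l] m l deflate_pivot_column[OF X0 l(1)] by (simp add: Y_def)
              next
                case False
                then have "m < l" using m by simp
                then have "Y i m = 0" unfolding Y_def
                  using I_zero m l by (intro deflate_zero_column[OF X0 l(1)]) auto
                then show ?thesis using X3[of i m] m l by simp
              qed
            qed
            show "\<forall>b\<in>{4, 5, 6}. Re (form n (\<mu> b) ?w ?w) + Re (tr_prod n (\<mu> b) (\<mu>3 2)) = Re (tr_prod n (\<mu> b) (\<mu> 2))"
            proof
              fix b :: nat assume b: "b \<in> {4, 5, 6}"
              then have "Re (form n (\<mu> b) (acol \<mu>0 3) (acol \<mu>0 3)) + Re (tr_prod n (\<mu> b) (\<mu>0 2)) = Re (tr_prod n (\<mu> b) (\<mu> 2))"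
                by (rule bspec[OF I_eq])
              moreover have "Re (form n (\<mu> b) ?w ?w) = Re (form n (\<mu> b) (acol \<mu>0 3) (acol \<mu>0 3)) + Re (form n (\<mu> b) ?v ?v)"
                by (rule fm(1)) (use b in auto)
              ultimately show "Re (form n (\<mu> b) ?w ?w) + Re (tr_prod n (\<mu> b) (\<mu>3 2)) = Re (tr_prod n (\<mu> b) (\<mu> 2))"
                using tr[of "\<mu> b"] by linarith
            qed
            have "Re (form n (\<mu> 0) ?w ?w) \<ge> Re (form n (\<mu> 0) (acol \<mu>0 3) (acol \<mu>0 3)) + Re (form n (\<mu> 0) ?v ?v)"
              by (rule fm(2)) auto
            then show "Re (form n (\<mu> 0) ?w ?w) + Re (tr_prod n (\<mu> 0) (\<mu>3 2)) \<ge> Re (tr_prod n (\<mu> 0) (\<mu> 2))"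
              using I_ge tr[of "\<mu> 0"] by linarith
          qed
        qed
      qed
    qed
    then show "runs orc n S (Suc 2) (Seq pivot_prog (Seq deflate_prog
       (Seq (gram_prog 0) (Seq (gram_prog 4) (Seq (gram_prog 5) (Seq (gram_prog 6) merge_prog)))))) \<sigma>0 \<mu>0 (I (Suc l))"
      by simp
  qed (use \<sigma> in auto)
  then show ?thesis
  proof (rule runs_weaken)
    fix \<mu>' assume I: "I n \<mu>'"
    then have "\<mu>' 2 i k = 0" if "i < n" "k < n" for i k
      using that by (simp add: I_def)
    then have "tr_prod n B (\<mu>' 2) = 0" for B
      by (simp add: tr_prod_def)
    then show "(\<forall>b\<in>{4, 5, 6}. Re (form n (\<mu> b) (acol \<mu>' 3) (acol \<mu>' 3)) = Re (tr_prod n (\<mu> b) (\<mu> 2))) \<and>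
      Re (form n (\<mu> 0) (acol \<mu>' 3) (acol \<mu>' 3)) \<ge> Re (tr_prod n (\<mu> 0) (\<mu> 2))"
      using I by (simp add: I_def)
  qed
qed

section \<open>Matrices as arrays\<close>

lemma array_of_mat_simp [simp]:
  "A \<in> carrier_mat n n \<Longrightarrow> i < n \<Longrightarrow> k < n \<Longrightarrow> array_of_mat A i k = A $$ (i, k)"
  by (auto simp: array_of_mat_def)

lemma mat_of_array_of_mat: "A \<in> carrier_mat n n \<Longrightarrow> mat_of_array n (array_of_mat A) = A"
  by (auto simp: mat_of_array_def array_of_mat_def)

lemma array_of_one_mat: "array_of_mat (1\<^sub>m n) i k = (if i = k \<and> i < n then 1 else 0)"
  by (auto simp: array_of_mat_def)

lemma qform_eq_form:
  assumes "A \<in> carrier_mat n n" "t \<in> carrier_vec n"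
  shows "qform A t = Re (form n (array_of_mat A) (($) t) (($) t))"
proof -
  have "(A *\<^sub>v t) \<bullet>c t = (\<Sum>i<n. (\<Sum>k<n. A $$ (i, k) * t $ k) * cnj (t $ i))"
    using assms by (simp add: scalar_prod_def lessThan_atLeast0)
  also have "\<dots> = form n (array_of_mat A) (($) t) (($) t)"
    unfolding form_def sum_distrib_right using assms(1) by (intro sum.cong refl) (simp add: mult_ac)
  finally show ?thesis by (simp add: qform_def)
qed

lemma qform_vec: "A \<in> carrier_mat n n \<Longrightarrow> qform A (vec n u) = Re (form n (array_of_mat A) u u)"
  by (subst qform_eq_form) (auto intro!: form_cong arg_cong[where f = Re])

lemma norm_vec: "Re (vec n u \<bullet>c vec n u) = Re (form n (array_of_mat (1\<^sub>m n)) u u)"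
  using qform_vec[of "1\<^sub>m n" n u] by (simp add: qform_def)

lemma trace_mult:
  assumes "B \<in> carrier_mat n n" "X \<in> carrier_mat n n"
  shows "trace (B * X) = tr_prod n (array_of_mat B) (array_of_mat X)"
  using assms unfolding trace_def tr_prod_def
  by (auto simp: scalar_prod_def lessThan_atLeast0 intro!: sum.cong)

lemma mat_adjoint_index:
  "A \<in> carrier_mat n n \<Longrightarrow> i < n \<Longrightarrow> k < n \<Longrightarrow> mat_adjoint A $$ (i, k) = cnj (A $$ (k, i))"
  by (auto simp: mat_adjoint_def mat_of_rows_def)

lemma hermitian_mat_iff: "hermitian_mat n A \<longleftrightarrow> A \<in> carrier_mat n n \<and> herm n (array_of_mat A)"
proof (cases "A \<in> carrier_mat n n")
  case True
  then have "mat_adjoint A \<in> carrier_mat n n" by (auto simp: mat_adjoint_def)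
  then have "mat_adjoint A = A \<longleftrightarrow> (\<forall>i<n. \<forall>k<n. cnj (A $$ (k, i)) = A $$ (i, k))"
    using True mat_adjoint_index[OF True] by (auto simp: mat_eq_iff)
  also have "\<dots> \<longleftrightarrow> herm n (array_of_mat A)"
    unfolding herm_def using True by (metis array_of_mat_simp)
  finally show ?thesis using True by (simp add: hermitian_mat_def)
qed (simp add: hermitian_mat_def)

lemma psd_iff: "psd n X \<longleftrightarrow> X \<in> carrier_mat n n \<and> psd_arr n (array_of_mat X)"
proof (cases "X \<in> carrier_mat n n")
  case True
  have "(\<forall>v\<in>carrier_vec n. 0 \<le> qform X v) \<longleftrightarrow> (\<forall>u. 0 \<le> Re (form n (array_of_mat X) u u))"
  proof (intro iffI allI ballI)
    fix u assume "\<forall>v\<in>carrier_vec n. 0 \<le> qform X v"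
    then have "0 \<le> qform X (vec n u)" by simp
    also have "qform X (vec n u) = Re (form n (array_of_mat X) u u)"
      by (rule qform_vec[OF True])
    finally show "0 \<le> Re (form n (array_of_mat X) u u)" .
  qed (simp add: qform_eq_form[OF True])
  then show ?thesis
    using True by (simp add: psd_def psd_arr_def hermitian_mat_iff)
qed (simp add: psd_def hermitian_mat_def)

section \<open>Vectors as rank-one points of the relaxation\<close>

definition outer_mat :: "nat \<Rightarrow> complex vec \<Rightarrow> complex mat" where
  "outer_mat n u = mat n n (\<lambda>(i, k). u $ i * cnj (u $ k))"

lemma outer_mat_carrier [simp]: "outer_mat n u \<in> carrier_mat n n"
  by (simp add: outer_mat_def)

lemma array_of_outer_mat: "i < n \<Longrightarrow> k < n \<Longrightarrow> array_of_mat (outer_mat n u) i k = u $ i * cnj (u $ k)"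
  by (simp add: array_of_mat_def outer_mat_def)

lemma trace_outer_mat:
  assumes "B \<in> carrier_mat n n" "u \<in> carrier_vec n"
  shows "Re (trace (B * outer_mat n u)) = qform B u"
proof -
  have "tr_prod n (array_of_mat B) (array_of_mat (outer_mat n u)) = form n (array_of_mat B) (($) u) (($) u)"
    unfolding tr_prod_def form_def by (intro sum.cong refl) (simp add: array_of_outer_mat)
  then show ?thesis
    using assms by (simp add: trace_mult qform_eq_form)
qed

lemma psd_outer_mat: "psd n (outer_mat n u)"
  unfolding psd_iff psd_arr_def
proof (intro conjI allI)
  show "herm n (array_of_mat (outer_mat n u))"
    by (simp add: herm_def array_of_outer_mat)
  fix v
  have "form n (array_of_mat (outer_mat n u)) v v = (\<Sum>i<n. \<Sum>k<n. (cnj (v i) * u $ i) * cnj (cnj (v k) * u $ k))"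
    unfolding form_def by (intro sum.cong refl) (simp add: array_of_outer_mat)
  also have "\<dots> = (\<Sum>i<n. cnj (v i) * u $ i) * cnj (\<Sum>i<n. cnj (v i) * u $ i)"
    unfolding cnj_sum sum_product ..
  also have "\<dots> = complex_of_real ((cmod (\<Sum>i<n. cnj (v i) * u $ i))\<^sup>2)"
    by (rule complex_norm_square[symmetric])
  finally show "0 \<le> Re (form n (array_of_mat (outer_mat n u)) v v)" by simp
qed simp

lemma sdp_feasible_relaxation:
  "sdp_feasible M (relaxation M K Q P) X \<longleftrightarrow>
     psd M X \<and> (\<forall>k\<in>{1..K}. Re (trace (Q k * X)) \<le> 1) \<and> Re (trace (1\<^sub>m M * X)) \<le> P"
  unfolding sdp_feasible_def relaxation_def by (auto simp: less_Suc_eq_le)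

lemma outer_mat_feasible:
  assumes "qcqp_data M K A Q P" "qcqp_feasible M K Q P u"
  shows "sdp_feasible M (relaxation M K Q P) (outer_mat M u)"
proof -
  have u: "u \<in> carrier_vec M" using assms by (simp add: qcqp_feasible_def)
  have "Re (trace (1\<^sub>m M * outer_mat M u)) = Re (u \<bullet>c u)"
    using trace_outer_mat[OF one_carrier_mat u] u by (simp add: qform_def)
  moreover have "Re (trace (Q k * outer_mat M u)) = qform (Q k) u" if "k \<in> {1..K}" for k
    using assms(1) that u by (intro trace_outer_mat) (auto simp: qcqp_data_def psd_iff)
  ultimately show ?thesis
    using assms(2) by (simp add: sdp_feasible_relaxation psd_outer_mat qcqp_feasible_def)
qed

text \<open>The lift to a rank-one matrix bounds the value of every feasible vector by the optimum
  of the relaxation, so a feasible vector that reaches this optimum is optimal.\<close>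

lemma qcqp_optimal_if_tight:
  assumes "qcqp_data M K A Q P" "sdp_optimal M A (relaxation M K Q P) X"
    and "qcqp_feasible M K Q P w" "Re (trace (A * X)) \<le> qform A w"
  shows "qcqp_optimal M K A Q P w"
  unfolding qcqp_optimal_def
proof (intro conjI allI impI assms(3))
  fix u assume u: "qcqp_feasible M K Q P u"
  have "qform A u = Re (trace (A * outer_mat M u))"
    using assms(1) u by (intro trace_outer_mat[symmetric]) (auto simp: qcqp_data_def psd_iff qcqp_feasible_def)
  also have "\<dots> \<le> Re (trace (A * X))"
    using assms(2) outer_mat_feasible[OF assms(1) u] unfolding sdp_optimal_def by blast
  finally show "qform A u \<le> qform A w" using assms(4) by linarith
qed

section \<open>The complete programs\<close>

text \<open>The identity directly follows the array of \<open>Q K\<close>, so that all constraint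
  matrices are consecutive from array 4 on, as \<open>SolveSDP\<close> expects.\<close>

definition identity_prog :: com where
  "identity_prog = For 2 (Store (IAdd (INum 4) (IVar 1)) (IVar 2) (IVar 2) (CNum 1))"

text \<open>Writing 1 twice and then \<open>P\<close> at position \<open>K\<close> serves
  \<open>K = 1\<close> and \<open>K = 2\<close> without a branch: for \<open>K = 1\<close> the
  second 1 is overwritten.\<close>

definition rhs_prog :: com where
  "rhs_prog = Seq (Store (INum 7) (INum 0) (INum 0) (CNum 1)) (Seq (Store (INum 7) (INum 1) (INum 0) (CNum 1))
     (Store (INum 7) (IVar 1) (INum 0) (CLoad (INum 1) (INum 0) (INum 0))))"

definition solve_call :: com where
  "solve_call = SolveSDP (IVar 0) (IAdd (IVar 1) (INum 1)) (INum 0) (INum 4) (INum 7) (INum 2)"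

definition prepared :: "nat \<Rightarrow> nat \<Rightarrow> complex mat \<Rightarrow> (nat \<Rightarrow> complex mat) \<Rightarrow> store \<Rightarrow> bool" where
  "prepared M K A Q \<mu> \<longleftrightarrow> \<mu> 0 = array_of_mat A \<and> (\<forall>k\<in>{1..K}. \<mu> (3 + k) = array_of_mat (Q k)) \<and>
     \<mu> (4 + K) = array_of_mat (1\<^sub>m M) \<and> (K = 1 \<longrightarrow> \<mu> 6 = (\<lambda>_ _. 0)) \<and> (\<forall>i. acol \<mu> 3 i = 0)"

lemma runs_identity_prog:
  assumes "\<sigma> 0 = n" "\<sigma> 1 = K"
  shows "runs orc n S 2 identity_prog \<sigma> \<mu> (\<lambda>\<mu>'. (\<forall>a. a \<noteq> 4 + K \<longrightarrow> \<mu>' a = \<mu> a) \<and>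
    (\<forall>i k. \<mu>' (4 + K) i k = (if i = k \<and> i < n then 1 else \<mu> (4 + K) i k)))"
  unfolding identity_prog_def
proof (rule runs_For)
  fix l \<sigma>' \<mu>'
  assume "l < n" "\<forall>y<2. \<sigma>' y = \<sigma> y" "\<sigma>' 2 = l" and I: "(\<forall>a. a \<noteq> 4 + K \<longrightarrow> \<mu>' a = \<mu> a) \<and>
    (\<forall>i k. \<mu>' (4 + K) i k = (if i = k \<and> i < l then 1 else \<mu> (4 + K) i k))"
  then have "\<sigma>' 1 = K" using assms by simp
  then show "runs orc n S (Suc 2) (Store (IAdd (INum 4) (IVar 1)) (IVar 2) (IVar 2) (CNum 1)) \<sigma>' \<mu>'
    (\<lambda>\<mu>'. (\<forall>a. a \<noteq> 4 + K \<longrightarrow> \<mu>' a = \<mu> a) \<and>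
    (\<forall>i k. \<mu>' (4 + K) i k = (if i = k \<and> i < Suc l then 1 else \<mu> (4 + K) i k)))"
    using I \<open>\<sigma>' 2 = l\<close> by (intro runs_Store) (auto simp: less_Suc_eq)
qed (use assms in auto)

text \<open>Array 2 is left open, so that the lemma applies whether or not a solution of the
  relaxation is part of the input.\<close>

lemma prepared_identity:
  assumes "K \<le> 2" "1 \<le> K"
    and "\<forall>a. a \<noteq> 2 \<longrightarrow> \<mu> a = input_store K A Q P a"
    and "(\<forall>a. a \<noteq> 4 + K \<longrightarrow> \<mu>' a = \<mu> a) \<and> (\<forall>i k. \<mu>' (4 + K) i k = (if i = k \<and> i < M then 1 else \<mu> (4 + K) i k))"
  shows "prepared M K A Q \<mu>'"
proof -
  have inp: "\<mu>' a = input_store K A Q P a" if "a \<noteq> 2" "a \<noteq> 4 + K" for a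
    using assms(3,4) that by simp
  have "\<mu>' 0 = array_of_mat A"
    using inp[of 0] by (simp add: input_store_def fun_eq_iff)
  moreover have "\<mu>' (3 + k) = array_of_mat (Q k)" if "k \<in> {1..K}" for k
    using inp[of "3 + k"] that by (auto simp: input_store_def fun_eq_iff)
  moreover have "\<mu>' (4 + K) = array_of_mat (1\<^sub>m M)"
    using assms(3,4) by (simp add: fun_eq_iff array_of_one_mat input_store_def)
  moreover have "K = 1 \<longrightarrow> \<mu>' 6 = (\<lambda>_ _. 0)"
    using inp[of 6] by (auto simp: input_store_def fun_eq_iff)
  moreover have "acol \<mu>' 3 i = 0" for i
    using inp[of 3] assms(2) by (simp add: input_store_def acol_def)
  ultimately show ?thesis by (simp add: prepared_def)
qed

lemma runs_rounding:
  assumes data: "qcqp_data M K A Q P" "K \<le> 2" and X: "sdp_feasible M (relaxation M K Q P) X"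
    and \<mu>: "prepared M K A Q \<mu>" "\<mu> 2 = array_of_mat X" and \<sigma>: "\<sigma> 0 = M"
  shows "runs orc M S 2 rounding_prog \<sigma> \<mu> (\<lambda>\<mu>'. qcqp_feasible M K Q P (vec M (acol \<mu>' 3)) \<and>
    Re (trace (A * X)) \<le> qform A (vec M (acol \<mu>' 3)))"
proof (rule runs_weaken[OF runs_rounding_prog[where j = "4 + K"]])
  have K: "K = 1 \<or> K = 2" using data by (auto simp: qcqp_data_def)
  have XM: "X \<in> carrier_mat M M" and psdX: "psd M X" using X by (auto simp: sdp_feasible_relaxation psd_iff)
  have A: "A \<in> carrier_mat M M" "herm M (array_of_mat A)"
    and Q: "\<And>k. k \<in> {1..K} \<Longrightarrow> Q k \<in> carrier_mat M M \<and> herm M (array_of_mat (Q k))"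
    using data by (auto simp: qcqp_data_def psd_iff psd_arr_def)
  have Q': "\<mu> (3 + k) = array_of_mat (Q k)" if "k \<in> {1..K}" for k
    using \<mu>(1) that by (simp add: prepared_def)
  have J: "\<mu> (4 + K) = array_of_mat (1\<^sub>m M)" and A': "\<mu> 0 = array_of_mat A"
    using \<mu>(1) by (auto simp: prepared_def)
  show "\<sigma> 0 = M" by (rule \<sigma>)
  show "4 + K \<in> {4, 5, 6}" using K by auto
  show "psd_arr M (\<mu> 2)" using psdX \<mu> by (simp add: psd_iff)
  show "acol \<mu> 3 i = 0" if "i < M" for i using \<mu> by (simp add: prepared_def)
  show "form M (\<mu> (4 + K)) w w = complex_of_real (\<Sum>i<M. (cmod (w i))\<^sup>2)" for w
  proof -
    have "form M (\<mu> (4 + K)) w w = (\<Sum>i<M. cnj (w i) * w i)"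
      unfolding form_def J by (intro sum.cong refl)
        (simp add: array_of_one_mat if_distrib if_distribR sum.delta cong: if_cong)
    also have "\<dots> = complex_of_real (\<Sum>i<M. (cmod (w i))\<^sup>2)"
      unfolding of_real_sum complex_norm_square by (simp add: mult.commute)
    finally show ?thesis .
  qed
  show "herm M (\<mu> b)" if "b \<in> {0, 4, 5, 6}" for b
  proof -
    have "herm M (\<mu> (4 + K))"
      unfolding J herm_def by (simp add: array_of_one_mat)
    moreover have "herm M (\<mu> (3 + k))" if "k \<in> {1..K}" for k
      using Q[OF that] Q'[OF that] by simp
    note this[of 1] this[of 2]
    moreover have "K = 1 \<longrightarrow> herm M (\<mu> 6)"
      using \<mu>(1) by (simp add: prepared_def herm_def)
    ultimately show ?thesis using that K A(2) A' by auto
  qed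
  fix \<mu>'
  define w where "w = acol \<mu>' 3"
  assume R: "(\<forall>b\<in>{4, 5, 6}. Re (form M (\<mu> b) (acol \<mu>' 3) (acol \<mu>' 3)) = Re (tr_prod M (\<mu> b) (\<mu> 2))) \<and>
    Re (form M (\<mu> 0) (acol \<mu>' 3) (acol \<mu>' 3)) \<ge> Re (tr_prod M (\<mu> 0) (\<mu> 2))"
  have "qform (Q k) (vec M w) \<le> 1" if "k \<in> {1..K}" for k
  proof -
    have "3 + k \<in> {4, 5, 6}" using that K by auto
    then have "Re (form M (\<mu> (3 + k)) w w) = Re (tr_prod M (\<mu> (3 + k)) (\<mu> 2))"
      using R unfolding w_def by blast
    then have "qform (Q k) (vec M w) = Re (trace (Q k * X))"
      using Q[OF that] XM by (simp add: qform_vec trace_mult[where n = M] Q'[OF that] \<mu>(2))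
    then show ?thesis using X that by (simp add: sdp_feasible_relaxation)
  qed
  moreover have "Re (vec M w \<bullet>c vec M w) \<le> P"
  proof -
    have "4 + K \<in> {4, 5, 6}" using K by auto
    then have "Re (form M (\<mu> (4 + K)) w w) = Re (tr_prod M (\<mu> (4 + K)) (\<mu> 2))"
      using R unfolding w_def by blast
    then have "Re (vec M w \<bullet>c vec M w) = Re (trace (1\<^sub>m M * X))"
      by (simp only: norm_vec trace_mult[OF one_carrier_mat XM] J \<mu>(2))
    then show ?thesis using X by (simp only: sdp_feasible_relaxation)
  qed
  moreover have "Re (trace (A * X)) \<le> qform A (vec M w)"
    using R A XM by (simp add: qform_vec trace_mult[where n = M] A' \<mu>(2) w_def)
  ultimately show "qcqp_feasible M K Q P (vec M (acol \<mu>' 3)) \<and> Re (trace (A * X)) \<le> qform A (vec M (acol \<mu>' 3))"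
    by (simp add: qcqp_feasible_def w_def)
qed

lemma runs_identity_rounding:
  assumes data: "qcqp_data M K A Q P" "K \<le> 2" and X: "sdp_feasible M (relaxation M K Q P) X"
  shows "runs orc M S 2 (Seq identity_prog rounding_prog) (input_vars M K)
    ((input_store K A Q P)(2 := array_of_mat X)) (\<lambda>\<mu>'. qcqp_feasible M K Q P (vec M (acol \<mu>' 3)) \<and>
    Re (trace (A * X)) \<le> qform A (vec M (acol \<mu>' 3)))"
proof (rule runs_Seq[OF runs_identity_prog])
  show "input_vars M K 0 = M" "input_vars M K 1 = K" by (auto simp: input_vars_def)
  fix \<sigma>' \<mu>'
  assume 1: "\<forall>y<2. \<sigma>' y = input_vars M K y"
    "(\<forall>a. a \<noteq> 4 + K \<longrightarrow> \<mu>' a = ((input_store K A Q P)(2 := array_of_mat X)) a) \<and>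
     (\<forall>i k. \<mu>' (4 + K) i k = (if i = k \<and> i < M then 1 else ((input_store K A Q P)(2 := array_of_mat X)) (4 + K) i k))"
  have "prepared M K A Q \<mu>'"
    by (rule prepared_identity[OF data(2) _ _ 1(2)]) (use data in \<open>auto simp: qcqp_data_def\<close>)
  moreover have "\<mu>' 2 = array_of_mat X" using 1(2) by simp
  moreover have "\<sigma>' 0 = M" using 1(1) by (simp add: input_vars_def)
  ultimately show "runs orc M S 2 rounding_prog \<sigma>' \<mu>' (\<lambda>\<mu>'. qcqp_feasible M K Q P (vec M (acol \<mu>' 3)) \<and>
    Re (trace (A * X)) \<le> qform A (vec M (acol \<mu>' 3)))"
    by (rule runs_rounding[OF data X])
qed

section \<open>Existence of an optimal solution of the relaxation\<close>

lemma continuous_on_form: "continuous_on UNIV (\<lambda>f :: nat \<Rightarrow> complex. Re (form n B f f))"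
  unfolding form_def by (intro continuous_intros continuous_on_product_coordinates)

text \<open>Vectors are taken as functions supported below \<open>n\<close>, for which compactness
  is Tychonoff's theorem in the product topology.\<close>

lemma compact_bounded_fun:
  "compact {f :: nat \<Rightarrow> complex. (\<forall>i<n. cmod (f i) \<le> r) \<and> (\<forall>i\<ge>n. f i = 0)}"
proof -
  define T where "T i = (if i < n then cball (0 :: complex) r else {0})" for i
  have "compactin (product_topology (\<lambda>_. euclidean) UNIV) (PiE UNIV T)"
    unfolding compactin_PiE by (simp add: T_def)
  then have "compact (PiE UNIV T)"
    by (simp add: euclidean_product_topology)
  moreover have "PiE UNIV T = {f. (\<forall>i<n. cmod (f i) \<le> r) \<and> (\<forall>i\<ge>n. f i = 0)}"
    by (auto simp: T_def PiE_UNIV_domain Pi_iff split: if_splits)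
  ultimately show ?thesis by simp
qed

lemma qcqp_optimal_exists:
  assumes data: "qcqp_data M K A Q P"
  shows "\<exists>w. qcqp_optimal M K A Q P w"
proof -
  \<comment> \<open>The power constraint bounds each coordinate by \<open>sqrt P\<close>, so the
    feasible set is closed in this compact box.\<close>
  define C where "C = {f :: nat \<Rightarrow> complex. (\<forall>i<M. cmod (f i) \<le> sqrt P) \<and> (\<forall>i\<ge>M. f i = 0)}"
  define J where "J = array_of_mat (1\<^sub>m M)"
  define F where "F = C \<inter> ({f. Re (form M J f f) \<le> P} \<inter> (\<Inter>k\<in>{1..K}. {f. Re (form M (array_of_mat (Q k)) f f) \<le> 1}))"
  have "compact F"
    unfolding F_def C_def
    by (intro compact_Int_closed[OF compact_bounded_fun] closed_Int closed_INT ballI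
        closed_Collect_le continuous_on_form continuous_intros)
  moreover have "(\<lambda>_. 0) \<in> F"
    using data by (auto simp: F_def C_def form_def qcqp_data_def)
  ultimately obtain f where f: "f \<in> F"
      and max: "\<And>g. g \<in> F \<Longrightarrow> Re (form M (array_of_mat A) g g) \<le> Re (form M (array_of_mat A) f f)"
    using continuous_attains_sup[of F "\<lambda>f. Re (form M (array_of_mat A) f f)"]
      continuous_on_subset[OF continuous_on_form] by blast
  have A: "A \<in> carrier_mat M M" and Q: "\<And>k. k \<in> {1..K} \<Longrightarrow> Q k \<in> carrier_mat M M"
    using data by (auto simp: qcqp_data_def psd_iff)
  have feas: "qcqp_feasible M K Q P (vec M g) \<longleftrightarrow> Re (form M J g g) \<le> P \<and>
      (\<forall>k\<in>{1..K}. Re (form M (array_of_mat (Q k)) g g) \<le> 1)" for g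
    using Q by (simp add: qcqp_feasible_def norm_vec qform_vec J_def conj_commute)
  have "qform A u \<le> qform A (vec M f)" if u: "qcqp_feasible M K Q P u" for u
  proof -
    define g where "g i = (if i < M then u $ i else 0)" for i
    have ug: "u = vec M g" using u by (auto simp: g_def qcqp_feasible_def)
    have "form M J g g = complex_of_real (\<Sum>i<M. (cmod (g i))\<^sup>2)"
      unfolding J_def form_def of_real_sum complex_norm_square
      by (intro sum.cong refl) (simp add: array_of_one_mat if_distrib if_distribR sum.delta mult.commute cong: if_cong)
    then have le: "(\<Sum>i<M. (cmod (g i))\<^sup>2) \<le> P"
      using u unfolding ug feas by simp
    have "cmod (g i) \<le> sqrt P" if "i < M" for i
    proof -
      have "(cmod (g i))\<^sup>2 \<le> (\<Sum>i<M. (cmod (g i))\<^sup>2)"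
        using that by (intro member_le_sum) auto
      then show ?thesis using le by (intro real_le_rsqrt) linarith
    qed
    then have "g \<in> F"
      using u unfolding ug feas by (auto simp: F_def C_def g_def)
    then show ?thesis
      using max[of g] A by (simp add: ug qform_vec)
  qed
  moreover have "qcqp_feasible M K Q P (vec M f)"
    using f unfolding feas by (auto simp: F_def)
  ultimately show ?thesis unfolding qcqp_optimal_def by blast
qed

text \<open>The rounding program turns any feasible point of the relaxation into a feasible vector that is
  at least as good, so an optimal vector of the QCQP yields an optimal matrix.\<close>

lemma relaxation_optimal_exists:
  assumes data: "qcqp_data M K A Q P" "K \<le> 2"
  shows "\<exists>X. sdp_optimal M A (relaxation M K Q P) X"
proof -
  obtain w where w: "qcqp_optimal M K A Q P w"
    using qcqp_optimal_exists[OF data(1)] by blast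
  then have feas: "qcqp_feasible M K Q P w" by (simp add: qcqp_optimal_def)
  have "Re (trace (A * Y)) \<le> Re (trace (A * outer_mat M w))"
    if Y: "sdp_feasible M (relaxation M K Q P) Y" for Y
  proof -
    \<comment> \<open>The run serves only as an existence proof for the rounded vector. The program
      makes no call, so \<open>no_solver\<close> and the time 0 will do.\<close>
    obtain v where "qcqp_feasible M K Q P v" "Re (trace (A * Y)) \<le> qform A v"
      using runs_identity_rounding[OF data Y, where orc = no_solver and S = 0] unfolding runs_def by blast
    moreover from this have "qform A v \<le> qform A w" using w by (simp add: qcqp_optimal_def)
    moreover have "Re (trace (A * outer_mat M w)) = qform A w"
      using data feas by (intro trace_outer_mat) (auto simp: qcqp_data_def psd_iff qcqp_feasible_def)
    ultimately show ?thesis by linarith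
  qed
  then show ?thesis
    using outer_mat_feasible[OF data(1) feas] unfolding sdp_optimal_def by blast
qed


section \<open>Calling the solver\<close>

lemma runs_solve_call:
  assumes data: "qcqp_data M K A Q P" "K \<le> 2"
    and solver: "orc M A (relaxation M K Q P) = Some (X, t)" "t \<le> S"
    and \<mu>: "prepared M K A Q \<mu>" "\<And>k. k < K \<Longrightarrow> \<mu> 7 k 0 = 1" "\<mu> 7 K 0 = complex_of_real P"
    and \<sigma>: "\<sigma> 0 = M" "\<sigma> 1 = K"
  shows "runs orc M S 2 solve_call \<sigma> \<mu> (\<lambda>\<mu>'. \<mu>' = \<mu>(2 := array_of_mat X))"
proof -
  \<comment> \<open>Positions in the list count from 0 and links from 1: position \<open>k\<close>
    stands for \<open>Q (Suc k)\<close>, which is in array \<open>4 + k\<close>.\<close>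
  have "map (\<lambda>k. (mat_of_array M (\<mu> (4 + k)), Re (\<mu> 7 k 0))) [0..<Suc K] = relaxation M K Q P"
  proof -
    have "map (\<lambda>k. (mat_of_array M (\<mu> (4 + k)), Re (\<mu> 7 k 0))) [0..<K] = map (\<lambda>k. (Q (Suc k), 1)) [0..<K]"
    proof (intro map_cong refl)
      fix k assume "k \<in> set [0..<K]"
      then have "Suc k \<in> {1..K}" "k < K" by auto
      then have "\<mu> (3 + Suc k) = array_of_mat (Q (Suc k))" "Q (Suc k) \<in> carrier_mat M M" "\<mu> 7 k 0 = 1"
        using \<mu>(1,2) data(1) unfolding prepared_def qcqp_data_def psd_iff by blast+
      then show "(mat_of_array M (\<mu> (4 + k)), Re (\<mu> 7 k 0)) = (Q (Suc k), 1)"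
        by (simp add: mat_of_array_of_mat)
    qed
    also have "\<dots> = map (\<lambda>k. (Q k, 1)) [1..<Suc K]"
      by (simp add: map_Suc_upt[symmetric] comp_def del: map_Suc_upt upt_Suc)
    finally show ?thesis
      using \<mu>(1,3) by (simp add: relaxation_def prepared_def mat_of_array_of_mat)
  qed
  moreover have "mat_of_array M (\<mu> 0) = A"
    using \<mu>(1) data(1) by (simp add: prepared_def qcqp_data_def psd_iff mat_of_array_of_mat)
  ultimately have "exec orc solve_call (\<sigma>, \<mu>)
      (1 + icost (IVar 0) + icost (IAdd (IVar 1) (INum 1)) + icost (INum 0) + icost (INum 4) +
        icost (INum 7) + icost (INum 2) + t) (\<sigma>, \<mu>(ival (INum 2) \<sigma> := array_of_mat X))"
    unfolding solve_call_def using solver(1) \<sigma> by (intro exec.SolveSDP) simp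
  then show ?thesis
    unfolding runs_def using solver(2) by (intro exI conjI) (auto simp: solve_call_def)
qed

lemma runs_solve_and_round:
  assumes data: "qcqp_data M K A Q P" "K \<le> 2"
    and solver: "orc M A (relaxation M K Q P) = Some (X, t)" "t \<le> S"
    and X: "sdp_optimal M A (relaxation M K Q P) X"
  shows "runs orc M S 2 (Seq identity_prog (Seq rhs_prog (Seq solve_call rounding_prog))) (input_vars M K)
    (input_store K A Q P) (\<lambda>\<mu>'. qcqp_feasible M K Q P (vec M (acol \<mu>' 3)) \<and>
    Re (trace (A * X)) \<le> qform A (vec M (acol \<mu>' 3)))"
    (is "runs _ _ _ _ _ _ _ ?R")
proof (rule runs_Seq[OF runs_identity_prog])
  show in_vars: "input_vars M K 0 = M" "input_vars M K 1 = K" by (auto simp: input_vars_def)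
  have K: "K = 1 \<or> K = 2" using data by (auto simp: qcqp_data_def)
  have feas: "sdp_feasible M (relaxation M K Q P) X" using X by (simp add: sdp_optimal_def)
  fix \<sigma>1 \<mu>1
  assume 1: "\<forall>y<2. \<sigma>1 y = input_vars M K y"
    "(\<forall>a. a \<noteq> 4 + K \<longrightarrow> \<mu>1 a = input_store K A Q P a) \<and>
     (\<forall>i k. \<mu>1 (4 + K) i k = (if i = k \<and> i < M then 1 else input_store K A Q P (4 + K) i k))"
  have p1: "prepared M K A Q \<mu>1"
    by (rule prepared_identity[OF data(2) _ _ 1(2)]) (use data in \<open>auto simp: qcqp_data_def\<close>)
  have P1: "\<mu>1 1 0 0 = complex_of_real P"
    using 1(2) by (simp add: input_store_def)
  have \<sigma>1: "\<sigma>1 0 = M" "\<sigma>1 1 = K" using 1(1) in_vars by simp_all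
  define \<mu>2 where "\<mu>2 = put 7 K 0 (complex_of_real P) (put 7 1 0 1 (put 7 0 0 1 \<mu>1))"
  have rhs: "runs orc M S 2 rhs_prog \<sigma>1 \<mu>1 (\<lambda>\<mu>'. \<mu>' = \<mu>2)"
    unfolding rhs_prog_def
  proof (rule runs_Seq[where R' = "\<lambda>\<mu>'. \<mu>' = put 7 0 0 1 \<mu>1"])
    fix \<sigma>2 \<mu>' assume 2: "\<forall>y<2. \<sigma>2 y = \<sigma>1 y" "\<mu>' = put 7 0 0 1 \<mu>1"
    show "runs orc M S 2 (Seq (Store (INum 7) (INum 1) (INum 0) (CNum 1))
     (Store (INum 7) (IVar 1) (INum 0) (CLoad (INum 1) (INum 0) (INum 0)))) \<sigma>2 \<mu>' (\<lambda>\<mu>'. \<mu>' = \<mu>2)"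
    proof (rule runs_Seq[where R' = "\<lambda>\<mu>'. \<mu>' = put 7 1 0 1 (put 7 0 0 1 \<mu>1)"])
      fix \<sigma>3 \<mu>'' assume 3: "\<forall>y<2. \<sigma>3 y = \<sigma>2 y" "\<mu>'' = put 7 1 0 1 (put 7 0 0 1 \<mu>1)"
      have "\<sigma>3 1 = K" using 3 2 \<sigma>1 by simp
      moreover have "\<mu>'' 1 0 0 = complex_of_real P" using P1 by (simp add: 3(2) put_def)
      ultimately show "runs orc M S 2 (Store (INum 7) (IVar 1) (INum 0) (CLoad (INum 1) (INum 0) (INum 0)))
         \<sigma>3 \<mu>'' (\<lambda>\<mu>'. \<mu>' = \<mu>2)"
        by (intro runs_put) (simp add: \<mu>2_def 3(2))
    qed (rule runs_put, simp add: 2(2))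
  qed (rule runs_put, simp)
  have other: "\<mu>2 a = \<mu>1 a" if "a \<noteq> 7" for a
    using that by (simp add: \<mu>2_def put_def)
  have p2: "prepared M K A Q \<mu>2"
    unfolding prepared_def
  proof (intro conjI ballI allI)
    fix k assume k: "k \<in> {1..K}"
    then have "3 + k \<noteq> 7" using data(2) by auto
    then show "\<mu>2 (3 + k) = array_of_mat (Q k)"
      using other p1 k unfolding prepared_def by metis
  next
    have "4 + K \<noteq> 7" using data(2) by auto
    then show "\<mu>2 (4 + K) = array_of_mat (1\<^sub>m M)"
      using other p1 unfolding prepared_def by metis
  qed (use p1 in \<open>simp_all add: prepared_def other acol_def\<close>)
  have one: "\<mu>2 7 k 0 = 1" if "k < K" for k
    using that K by (auto simp: \<mu>2_def put_def)
  have PK: "\<mu>2 7 K 0 = complex_of_real P"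
    by (simp add: \<mu>2_def put_def)
  show "runs orc M S 2 (Seq rhs_prog (Seq solve_call rounding_prog)) \<sigma>1 \<mu>1 ?R"
  proof (rule runs_Seq[OF rhs])
    fix \<sigma>2 \<mu>' assume 2: "\<forall>y<2. \<sigma>2 y = \<sigma>1 y" "\<mu>' = \<mu>2"
    have \<sigma>2: "\<sigma>2 0 = M" "\<sigma>2 1 = K" using 2 \<sigma>1 by simp_all
    show "runs orc M S 2 (Seq solve_call rounding_prog) \<sigma>2 \<mu>' ?R"
      unfolding 2(2)
    proof (rule runs_Seq)
      show "runs orc M S 2 solve_call \<sigma>2 \<mu>2 (\<lambda>\<mu>'. \<mu>' = \<mu>2(2 := array_of_mat X))"
        by (rule runs_solve_call[where orc = orc, OF data solver p2 _ PK \<sigma>2]) (rule one)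
      fix \<sigma>3 \<mu>3
      assume 3: "\<forall>y<2. \<sigma>3 y = \<sigma>2 y" "\<mu>3 = \<mu>2(2 := array_of_mat X)"
      have "prepared M K A Q \<mu>3"
        using p2 by (auto simp: prepared_def 3(2) acol_def)
      then show "runs orc M S 2 rounding_prog \<sigma>3 \<mu>3 ?R"
        by (rule runs_rounding[OF data feas]) (use 3 \<sigma>2 in simp_all)
    qed
  qed
qed

lemma exec_of_runs:
  assumes "runs orc M S 2 c \<sigma> \<mu> (\<lambda>\<mu>'. qcqp_feasible M K Q P (vec M (acol \<mu>' 3)) \<and>
      Re (trace (A * X)) \<le> qform A (vec M (acol \<mu>' 3)))"
    and "qcqp_data M K A Q P" "sdp_optimal M A (relaxation M K Q P) X" "time_bound M S c \<le> b"
  shows "\<exists>t s. exec orc c (\<sigma>, \<mu>) t s \<and> t \<le> b \<and> qcqp_optimal M K A Q P (output_vec M s)"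
proof -
  obtain t \<sigma>' \<mu>' where "exec orc c (\<sigma>, \<mu>) t (\<sigma>', \<mu>')" "t \<le> time_bound M S c"
      "qcqp_feasible M K Q P (vec M (acol \<mu>' 3))" "Re (trace (A * X)) \<le> qform A (vec M (acol \<mu>' 3))"
    using assms(1) unfolding runs_def by blast
  moreover have "output_vec M (\<sigma>', \<mu>') = vec M (acol \<mu>' 3)"
    by (auto simp: output_vec_def acol_def)
  ultimately show ?thesis
    using qcqp_optimal_if_tight[OF assms(2,3)] assms(4) by (metis le_trans)
qed

theorem proposition2:
  shows
    "(\<exists>c. \<forall>orc. poly_time_sdp_solver orc \<longrightarrow>
        (\<exists>p :: nat poly. \<forall>M K A Q P. qcqp_data M K A Q P \<and> K \<le> 2 \<longrightarrow>
           (\<exists>t s. exec orc c (input_qcqp M K A Q P) t s \<and> t \<le> poly p M \<and>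
                  qcqp_optimal M K A Q P (output_vec M s)))) \<and>
     (\<exists>c. \<exists>p :: nat poly. \<forall>M K A Q P X.
        qcqp_data M K A Q P \<and> K \<le> 2 \<and> sdp_optimal M A (relaxation M K Q P) X \<longrightarrow>
           (\<exists>t s. exec no_solver c (input_qcqp_with M K A Q P X) t s \<and> t \<le> poly p M \<and>
                  qcqp_optimal M K A Q P (output_vec M s)))"
proof (intro conjI)
  define c where "c = Seq identity_prog rounding_prog"
  \<comment> \<open>The program contains no call of the solver, hence the solver time 0.\<close>
  obtain p where p: "\<And>n. time_bound n 0 c \<le> poly p n"
    using poly_bounded_time_bound[OF poly_bounded_const, of 0 c] unfolding poly_bounded_def by blast
  have "\<exists>t s. exec no_solver c (input_qcqp_with M K A Q P X) t s \<and> t \<le> poly p M \<and>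
      qcqp_optimal M K A Q P (output_vec M s)"
    if data: "qcqp_data M K A Q P" "K \<le> 2" and X: "sdp_optimal M A (relaxation M K Q P) X" for M K A Q P X
    unfolding input_qcqp_with_def
    by (rule exec_of_runs[OF runs_identity_rounding[OF data] data(1) X, folded c_def, OF _ p])
      (use X in \<open>simp add: sdp_optimal_def\<close>)
  then show "\<exists>c. \<exists>p :: nat poly. \<forall>M K A Q P X.
        qcqp_data M K A Q P \<and> K \<le> 2 \<and> sdp_optimal M A (relaxation M K Q P) X \<longrightarrow>
           (\<exists>t s. exec no_solver c (input_qcqp_with M K A Q P X) t s \<and> t \<le> poly p M \<and>
                  qcqp_optimal M K A Q P (output_vec M s))"
    by blast
next
  define c where "c = Seq identity_prog (Seq rhs_prog (Seq solve_call rounding_prog))"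
  have "\<exists>p :: nat poly. \<forall>M K A Q P. qcqp_data M K A Q P \<and> K \<le> 2 \<longrightarrow>
           (\<exists>t s. exec orc c (input_qcqp M K A Q P) t s \<and> t \<le> poly p M \<and>
                  qcqp_optimal M K A Q P (output_vec M s))"
    if orc: "poly_time_sdp_solver orc" for orc
  proof -
    obtain q :: "nat poly" where q: "\<And>n C cs. hermitian_mat n C \<Longrightarrow> \<forall>(B, b)\<in>set cs. hermitian_mat n B \<Longrightarrow>
        \<exists>X. sdp_optimal n C cs X \<Longrightarrow>
        \<exists>X t. orc n C cs = Some (X, t) \<and> sdp_optimal n C cs X \<and> t \<le> poly q (n + length cs)"
      using orc unfolding poly_time_sdp_solver_def by blast
    \<comment> \<open>Polynomials with natural coefficients are monotone, so a bound on the number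
      of constraints may be inserted.\<close>
    have q_mono: "poly q a \<le> poly q b" if "a \<le> b" for a b
      using that by (induction q) (auto intro!: add_mono mult_mono)
    \<comment> \<open>For \<open>K <= 2\<close> the relaxation has at most three
      constraints.\<close>
    define S where "S n = poly q (n + 3)" for n
    have "poly_bounded S"
      unfolding poly_bounded_def S_def
      by (rule exI[of _ "pcompose q [:3, 1:]"]) (simp add: poly_pcompose add.commute)
    then obtain p where p: "\<And>n. time_bound n (S n) c \<le> poly p n"
      using poly_bounded_time_bound[of S c] unfolding poly_bounded_def by blast
    have "\<exists>t s. exec orc c (input_qcqp M K A Q P) t s \<and> t \<le> poly p M \<and>
        qcqp_optimal M K A Q P (output_vec M s)" if data: "qcqp_data M K A Q P" "K \<le> 2" for M K A Q P
    proof -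
      have "hermitian_mat M A" "\<forall>(B, b)\<in>set (relaxation M K Q P). hermitian_mat M B"
        using data(1) by (auto simp: qcqp_data_def psd_def relaxation_def hermitian_mat_iff[of M "1\<^sub>m M"]
            herm_def array_of_one_mat)
      \<comment> \<open>The solver promises an answer only if the optimum is attained, which
        \<open>relaxation_optimal_exists\<close> guarantees.\<close>
      then obtain X t where X: "orc M A (relaxation M K Q P) = Some (X, t)"
          "sdp_optimal M A (relaxation M K Q P) X" "t \<le> poly q (M + length (relaxation M K Q P))"
        using q relaxation_optimal_exists[OF data] by blast
      have "length (relaxation M K Q P) \<le> 3"
        using data(2) by (simp add: relaxation_def)
      then have "t \<le> S M"
        using X(3) q_mono[of "M + length (relaxation M K Q P)" "M + 3"] by (simp add: S_def)
      from exec_of_runs[OF runs_solve_and_round[where orc = orc, OF data X(1) this X(2)] data(1) X(2), folded c_def, OF p]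
      show ?thesis unfolding input_qcqp_def .
    qed
    then show ?thesis by blast
  qed
  then show "\<exists>c. \<forall>orc. poly_time_sdp_solver orc \<longrightarrow>
        (\<exists>p :: nat poly. \<forall>M K A Q P. qcqp_data M K A Q P \<and> K \<le> 2 \<longrightarrow>
           (\<exists>t s. exec orc c (input_qcqp M K A Q P) t s \<and> t \<le> poly p M \<and>
                  qcqp_optimal M K A Q P (output_vec M s)))"
    by blast
qed

end
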